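(* Let $\alpha>0$, $\beta>0$, $\gamma>0$, $\delta_{in}>0$, $\delta_{out}>0$, and let $d_1\ge2$, $d_2\ge2$ be fixed integers. Let $X(t,d_1,d_2)$ be the number of edges (counted with multiplicity) of the random graph $\mathcal G(t)$ whose source has out-degree $d_1$, whose target has in-degree $d_2$, and whose source and target are different. Then $$|X(t,d_1,d_2)-\mathbf E X(t,d_1,d_2)|<\sqrt t\,\ln t$$ with probability tending to $1$ as $t\to\infty$.
   Context: The model $\mathcal G(t)$. Parameters: $\alpha,\beta,\gamma\in[0,1]$ with $\alpha+\beta+\gamma=1$; reals $\delta_{in}\ge0$, $\delta_{out}\ge0$; a fixed finite directed graph $G_0$ (loops and multiple edges allowed) with at least one vertex, and with at least one edge if $\delta_{in}=0$ or $\delta_{out}=0$. Let $t_0$ be the number of edges of $G_0$. At time $t_0$ the random graph is $G_0$. Given the random graph $G$ at time $t\ge t_0$ (it has $t$ edges; let $n$ be its current number of vertices, $d_{in},d_{out}$ its in- and out-degrees), the graph at time $t+1$ is obtained by one of the following, chosen independently of the past: ($\dagger$) with probability $\alpha$, add a new vertex $v$ and an edge from $v$ to an existing vertex $w\in G$ chosen with probability $\frac{d_{in}(w)+\delta_{in}}{t+\delta_{in}n}$; ($\dagger\dagger$) with probability $\beta$, add an edge from $v\in G$ to $w\in G$, where $v$ is chosen with probability $\frac{d_{out}(v)+\delta_{out}}{t+\delta_{out}n}$ and, independently, $w$ with probability $\frac{d_{in}(w)+\delta_{in}}{t+\delta_{in}n}$; ($\ddagger$) with probability $\gamma$, add a new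 vertex $w$ and an edge to $w$ from an existing vertex $v\in G$ chosen with probability $\frac{d_{out}(v)+\delta_{out}}{t+\delta_{out}n}$. $\mathcal G(t)$ denotes the random graph at time $t$. *)

theory Defs
  imports
    "HOL-Probability.Probability"
    "HOL-Library.Infinite_Typeclass"
    "Graph_Theory.Digraph"
begin

text \<open>
  Graphs are finite multi-digraphs whose vertex and arc names are drawn from infinite types, so that
  an unused name always exists. Which unused name is taken is irrelevant up to isomorphism.
\<close>

definition fresh :: "'a::infinite set \<Rightarrow> 'a" where
  "fresh A = (SOME x. x \<notin> A)"

lemma fresh_notin: "finite A \<Longrightarrow> fresh A \<notin> A"
  unfolding fresh_def by (rule someI_ex) (rule arb_element)

text \<open>If \<open>v\<close> or \<open>w\<close> is not yet a vertex of \<open>G\<close>, it becomes one.\<close>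

definition attach_arc ::
    "'v \<Rightarrow> 'v \<Rightarrow> ('v, 'e::infinite) pre_digraph \<Rightarrow> ('v, 'e) pre_digraph" where
  "attach_arc v w G = (let e = fresh (arcs G) in
     \<lparr> verts = verts G \<union> {v, w}, arcs = insert e (arcs G),
       tail = (tail G)(e := v), head = (head G)(e := w) \<rparr>)"

text \<open>
  \<open>G\<close> is only ever the graph at time \<open>t\<close>, which has exactly \<open>t\<close> arcs (see \<open>graph_law_invariant\<close>),
  so the term \<open>t\<close> of the usual normalising constant is written \<open>card (arcs G)\<close>.
\<close>

definition preferential_pmf ::
    "('v \<Rightarrow> nat) \<Rightarrow> real \<Rightarrow> ('v, 'e) pre_digraph \<Rightarrow> 'v pmf" where
  "preferential_pmf deg \<delta> G = embed_pmf (\<lambda>v. if v \<in> verts G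
     then (real (deg v) + \<delta>) / (real (card (arcs G)) + \<delta> * real (card (verts G))) else 0)"

definition pick_by_in :: "real \<Rightarrow> ('v, 'e) pre_digraph \<Rightarrow> 'v pmf" where
  "pick_by_in \<delta>in G = preferential_pmf (in_degree G) \<delta>in G"

definition pick_by_out :: "real \<Rightarrow> ('v, 'e) pre_digraph \<Rightarrow> 'v pmf" where
  "pick_by_out \<delta>out G = preferential_pmf (out_degree G) \<delta>out G"

datatype step_kind = New_Source | Internal | New_Target

definition step_kind_pmf :: "real \<Rightarrow> real \<Rightarrow> real \<Rightarrow> step_kind pmf" where
  "step_kind_pmf \<alpha> \<beta> \<gamma> = embed_pmf (case_step_kind \<alpha> \<beta> \<gamma>)"

definition graph_step ::
    "real \<Rightarrow> real \<Rightarrow> real \<Rightarrow> real \<Rightarrow> real \<Rightarrow>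
     ('v::infinite, 'e::infinite) pre_digraph \<Rightarrow> ('v, 'e) pre_digraph pmf" where
  "graph_step \<alpha> \<beta> \<gamma> \<delta>in \<delta>out G = do {
     k \<leftarrow> step_kind_pmf \<alpha> \<beta> \<gamma>;
     case k of
       New_Source \<Rightarrow> do {
         w \<leftarrow> pick_by_in \<delta>in G;
         return_pmf (attach_arc (fresh (verts G)) w G) }
     | Internal \<Rightarrow> do {
         v \<leftarrow> pick_by_out \<delta>out G;
         w \<leftarrow> pick_by_in \<delta>in G;
         return_pmf (attach_arc v w G) }
     | New_Target \<Rightarrow> do {
         v \<leftarrow> pick_by_out \<delta>out G;
         return_pmf (attach_arc v (fresh (verts G)) G) }
   }"

primrec graph_after ::
    "real \<Rightarrow> real \<Rightarrow> real \<Rightarrow> real \<Rightarrow> real \<Rightarrow>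
     ('v::infinite, 'e::infinite) pre_digraph \<Rightarrow> nat \<Rightarrow> ('v, 'e) pre_digraph pmf" where
  "graph_after \<alpha> \<beta> \<gamma> \<delta>in \<delta>out G0 0 = return_pmf G0"
| "graph_after \<alpha> \<beta> \<gamma> \<delta>in \<delta>out G0 (Suc k) =
     bind_pmf (graph_after \<alpha> \<beta> \<gamma> \<delta>in \<delta>out G0 k) (graph_step \<alpha> \<beta> \<gamma> \<delta>in \<delta>out)"

text \<open>
  The law of the random graph at time \<open>t\<close>. The clock starts at \<open>card (arcs G0)\<close>; for smaller \<open>t\<close> the
  value is a dummy.
\<close>

definition graph_law ::
    "real \<Rightarrow> real \<Rightarrow> real \<Rightarrow> real \<Rightarrow> real \<Rightarrow>
     ('v::infinite, 'e::infinite) pre_digraph \<Rightarrow> nat \<Rightarrow> ('v, 'e) pre_digraph pmf" where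
  "graph_law \<alpha> \<beta> \<gamma> \<delta>in \<delta>out G0 t =
     graph_after \<alpha> \<beta> \<gamma> \<delta>in \<delta>out G0 (t - card (arcs G0))"

definition edge_count :: "nat \<Rightarrow> nat \<Rightarrow> ('v, 'e) pre_digraph \<Rightarrow> nat" where
  "edge_count d1 d2 G = card {e \<in> arcs G.
     out_degree G (tail G e) = d1 \<and> in_degree G (head G e) = d2 \<and> tail G e \<noteq> head G e}"

text \<open>
  The real functions passed to \<^const>\<open>embed_pmf\<close> above are genuine probability mass functions.
\<close>

lemma pmf_step_kind_pmf:
  assumes "\<alpha> \<ge> 0" "\<beta> \<ge> 0" "\<gamma> \<ge> 0" "\<alpha> + \<beta> + \<gamma> = 1"
  shows "pmf (step_kind_pmf \<alpha> \<beta> \<gamma>) k = (case k of New_Source \<Rightarrow> \<alpha> | Internal \<Rightarrow> \<beta> | New_Target \<Rightarrow> \<gamma>)"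
proof -
  have U: "(UNIV :: step_kind set) = {New_Source, Internal, New_Target}"
    using step_kind.exhaust by auto
  have fin: "finite (UNIV :: step_kind set)"
    by (simp add: U)
  have "(\<integral>\<^sup>+k. ennreal (case_step_kind \<alpha> \<beta> \<gamma> k) \<partial>count_space UNIV)
      = ennreal \<alpha> + (ennreal \<beta> + ennreal \<gamma>)"
    by (subst nn_integral_count_space_finite[OF fin]) (simp add: U)
  also have "\<dots> = 1"
    using assms by (simp flip: ennreal_plus add: add.assoc)
  finally show ?thesis
    unfolding step_kind_pmf_def using assms by (subst pmf_embed_pmf) (auto split: step_kind.split)
qed

lemma pmf_preferential_pmf:
  fixes G :: "('v, 'e) pre_digraph"
  assumes fin: "finite (verts G)" and ne: "verts G \<noteq> {}"
    and deg: "(\<Sum>v\<in>verts G. deg v) = card (arcs G)"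
    and \<delta>: "\<delta> \<ge> 0" "\<delta> > 0 \<or> arcs G \<noteq> {} \<and> finite (arcs G)"
  shows "pmf (preferential_pmf deg \<delta> G) v = (if v \<in> verts G
     then (real (deg v) + \<delta>) / (real (card (arcs G)) + \<delta> * real (card (verts G))) else 0)"
proof -
  define D where "D = real (card (arcs G)) + \<delta> * real (card (verts G))"
  have cv: "card (verts G) > 0"
    using fin ne by (simp add: card_gt_0_iff)
  have D: "D > 0"
    unfolding D_def
  proof (rule disjE[OF \<delta>(2)])
    assume "\<delta> > 0"
    with cv show "real (card (arcs G)) + \<delta> * real (card (verts G)) > 0"
      by (intro add_nonneg_pos mult_pos_pos) auto
  next
    assume "arcs G \<noteq> {} \<and> finite (arcs G)"
    with \<delta>(1) show "real (card (arcs G)) + \<delta> * real (card (verts G)) > 0"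
      by (intro add_pos_nonneg mult_nonneg_nonneg) (auto simp: card_gt_0_iff)
  qed
  let ?f = "\<lambda>v. if v \<in> verts G then (real (deg v) + \<delta>) / D else 0"
  have "(\<integral>\<^sup>+v. ennreal (?f v) \<partial>count_space UNIV) = (\<Sum>v\<in>verts G. ennreal (?f v))"
    using fin by (intro nn_integral_count_space') auto
  also have "\<dots> = ennreal (\<Sum>v\<in>verts G. ?f v)"
    using D \<delta> by (intro sum_ennreal) auto
  also have "(\<Sum>v\<in>verts G. ?f v) = ((\<Sum>v\<in>verts G. real (deg v)) + \<delta> * real (card (verts G))) / D"
    by (simp add: sum.distrib mult.commute flip: sum_divide_distrib)
  also have "\<dots> = 1"
    using D unfolding D_def by (simp flip: deg)
  finally have "(\<integral>\<^sup>+v. ennreal (?f v) \<partial>count_space UNIV) = 1" by simp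
  then show ?thesis
    unfolding preferential_pmf_def D_def[symmetric] using D \<delta> by (subst pmf_embed_pmf) auto
qed

lemma sum_in_degree:
  assumes "fin_digraph G"
  shows "(\<Sum>v\<in>verts G. in_degree G v) = card (arcs G)"
proof -
  interpret fin_digraph G by fact
  have "(\<Sum>v\<in>verts G. in_degree G v) = card (\<Union>v\<in>verts G. in_arcs G v)"
    unfolding in_degree_def by (rule card_UN_disjoint[symmetric]) auto
  also have "(\<Union>v\<in>verts G. in_arcs G v) = arcs G" by auto
  finally show ?thesis .
qed

lemma sum_out_degree:
  assumes "fin_digraph G"
  shows "(\<Sum>v\<in>verts G. out_degree G v) = card (arcs G)"
proof -
  interpret fin_digraph G by fact
  have "(\<Sum>v\<in>verts G. out_degree G v) = card (\<Union>v\<in>verts G. out_arcs G v)"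
    unfolding out_degree_def by (rule card_UN_disjoint[symmetric]) auto
  also have "(\<Union>v\<in>verts G. out_arcs G v) = arcs G" by auto
  finally show ?thesis .
qed

lemma pmf_pick_by_in:
  assumes "fin_digraph G" "verts G \<noteq> {}" "\<delta>in \<ge> 0" "\<delta>in > 0 \<or> arcs G \<noteq> {}"
  shows "pmf (pick_by_in \<delta>in G) w = (if w \<in> verts G
     then (real (in_degree G w) + \<delta>in) / (real (card (arcs G)) + \<delta>in * real (card (verts G))) else 0)"
proof -
  interpret fin_digraph G by fact
  show ?thesis
    unfolding pick_by_in_def by (rule pmf_preferential_pmf) (use assms sum_in_degree in auto)
qed

lemma pmf_pick_by_out:
  assumes "fin_digraph G" "verts G \<noteq> {}" "\<delta>out \<ge> 0" "\<delta>out > 0 \<or> arcs G \<noteq> {}"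
  shows "pmf (pick_by_out \<delta>out G) v = (if v \<in> verts G
     then (real (out_degree G v) + \<delta>out) / (real (card (arcs G)) + \<delta>out * real (card (verts G))) else 0)"
proof -
  interpret fin_digraph G by fact
  show ?thesis
    unfolding pick_by_out_def by (rule pmf_preferential_pmf) (use assms sum_out_degree in auto)
qed

lemma attach_arc_invariant:
  assumes "fin_digraph G"
  shows "fin_digraph (attach_arc v w G)" "verts (attach_arc v w G) \<noteq> {}"
    "card (arcs (attach_arc v w G)) = Suc (card (arcs G))"
proof -
  interpret fin_digraph G by fact
  have "fresh (arcs G) \<notin> arcs G" by (rule fresh_notin) simp
  then show "card (arcs (attach_arc v w G)) = Suc (card (arcs G))"
    by (simp add: attach_arc_def Let_def)
  show "fin_digraph (attach_arc v w G)"
    by unfold_locales (auto simp: attach_arc_def Let_def)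
  show "verts (attach_arc v w G) \<noteq> {}"
    by (auto simp: attach_arc_def Let_def)
qed

lemma graph_step_invariant:
  assumes "fin_digraph G" "H \<in> set_pmf (graph_step \<alpha> \<beta> \<gamma> \<delta>in \<delta>out G)"
  shows "fin_digraph H \<and> verts H \<noteq> {} \<and> card (arcs H) = Suc (card (arcs G))"
proof -
  from assms(2) obtain v w where "H = attach_arc v w G"
    unfolding graph_step_def set_bind_pmf
    by (elim UN_E, rename_tac k, case_tac k) auto
  then show ?thesis
    using attach_arc_invariant[OF assms(1)] by simp
qed

lemma graph_law_invariant:
  assumes "fin_digraph G0" "verts G0 \<noteq> {}" "t \<ge> card (arcs G0)"
    "G \<in> set_pmf (graph_law \<alpha> \<beta> \<gamma> \<delta>in \<delta>out G0 t)"
  shows "fin_digraph G \<and> verts G \<noteq> {} \<and> card (arcs G) = t"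
proof -
  have "G \<in> set_pmf (graph_after \<alpha> \<beta> \<gamma> \<delta>in \<delta>out G0 k) \<Longrightarrow>
      fin_digraph G \<and> verts G \<noteq> {} \<and> card (arcs G) = card (arcs G0) + k" for k G
  proof (induction k arbitrary: G)
    case (Suc k)
    then show ?case using graph_step_invariant by fastforce
  qed (use assms in auto)
  from this[of G "t - card (arcs G0)"] show ?thesis
    using assms by (auto simp: graph_law_def)
qed

end

theory Submission
  imports Defs "HOL-Real_Asymp.Real_Asymp"
begin

text \<open>
  The variance of \<open>X(t, d1, d2)\<close> is \<open>O(t)\<close>, so the claim follows from Chebyshev's inequality.
  Call a bounded function of the random graph concentrated if its variance is \<open>O(1/t)\<close>; such functions
  are closed under sums, products and inverses. If a statistic \<open>F\<close> changes by \<open>O(1)\<close> in each step and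
  its conditional expected increment is \<open>- A F / t + R\<close> with \<open>A \<ge> 0\<close> and \<open>R\<close> concentrated, then
  \<open>F / t\<close> is concentrated. This applies in turn to the number of vertices, to the numbers of vertices of
  given in- or out-degree (by induction on the degree), and to \<open>X(t, d1, d2)\<close> (by induction on \<open>d1\<close> and
  \<open>d2\<close>). Changing one step can move only boundedly many arcs into or out of the \<open>(d1, d2)\<close> class, because
  an arc counted there has at most \<open>d1\<close> arcs at its tail and \<open>d2\<close> at its head.
\<close>

section \<open>Variance growth in finitely supported chains\<close>

text \<open>The obstacle is the random denominator \<open>t + \<delta> n\<close> of the pick
  probabilities: it makes the coefficient \<open>A\<close> of the drift random and correlated with
  \<open>F\<close>. Replacing \<open>A\<close> by its mean costs an error
  \<open>(A - mean A) * F / t\<close>. Since \<open>F / t\<close> is bounded, this error is of the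
  size of the fluctuation of \<open>A\<close> and can join \<open>R\<close>. Hence \<open>A\<close>
  has to be concentrated too, and a uniform bound belongs to the notion of concentration. The sign
  \<open>A \<ge> 0\<close> gives the multiplier \<open>1 - mean A / t\<close>, which lies in
  \<open>[0, 1]\<close> for late times, so earlier noise is never amplified and the variance stays
  linear. The \<open>Internal\<close> step moves both endpoints at once and so brings in quantities
  with no concentration known at that point, among them the edge count under study. They always
  carry two pick probabilities, each \<open>O(1/t)\<close>, in front of a count \<open>O(t)\<close>.
  Such a term is \<open>O(1/t)\<close> pointwise and hence trivially concentrated, which avoids a
  circular argument. Second moments suffice because of the factor \<open>ln t\<close>: Chebyshev
  leaves a failure probability \<open>O(1 / (ln t)^2)\<close>.\<close>

lemma second_moment_pmf:
  fixes f :: "'a \<Rightarrow> real"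
  assumes "finite (set_pmf p)"
  shows "measure_pmf.expectation p (\<lambda>x. (f x - c)\<^sup>2)
       = measure_pmf.variance p f + (measure_pmf.expectation p f - c)\<^sup>2"
proof -
  note int = integrable_measure_pmf_finite[OF assms]
  define \<mu> where "\<mu> = measure_pmf.expectation p f"
  have "measure_pmf.expectation p (\<lambda>x. (f x - c)\<^sup>2)
      = measure_pmf.expectation p (\<lambda>x. (f x - \<mu>)\<^sup>2 + (2 * (\<mu> - c) * (f x - \<mu>) + (\<mu> - c)\<^sup>2))"
    by (simp add: power2_eq_square algebra_simps)
  also have "\<dots> = measure_pmf.variance p f + (\<mu> - c)\<^sup>2"
    by (simp add: int \<mu>_def)
  finally show ?thesis by (simp add: \<mu>_def)
qed

lemma variance_le_second_moment:
  fixes f :: "'a \<Rightarrow> real"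
  assumes "finite (set_pmf p)"
  shows "measure_pmf.variance p f \<le> measure_pmf.expectation p (\<lambda>x. (f x - c)\<^sup>2)"
  by (simp add: second_moment_pmf[OF assms, of f c])

lemma expectation_mono_pmf:
  fixes f :: "'a \<Rightarrow> real"
  assumes "finite (set_pmf p)" "\<And>x. x \<in> set_pmf p \<Longrightarrow> f x \<le> g x"
  shows "measure_pmf.expectation p f \<le> measure_pmf.expectation p g"
  by (intro integral_mono_AE integrable_measure_pmf_finite assms(1)) (simp add: AE_measure_pmf_iff assms(2))

lemma abs_expectation_le_pmf:
  fixes f :: "'a \<Rightarrow> real"
  assumes "finite (set_pmf p)" "\<And>x. x \<in> set_pmf p \<Longrightarrow> \<bar>f x\<bar> \<le> M"
  shows "\<bar>measure_pmf.expectation p f\<bar> \<le> M"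
proof -
  have "measure_pmf.expectation p f \<le> measure_pmf.expectation p (\<lambda>_. M)"
       "measure_pmf.expectation p (\<lambda>_. - M) \<le> measure_pmf.expectation p f"
    by (rule expectation_mono_pmf[OF assms(1)]; use assms(2) in force)+
  then show ?thesis by simp
qed

lemma expectation_bind_pmf:
  fixes f :: "'b \<Rightarrow> real"
  assumes "finite (set_pmf p)" "\<And>x. x \<in> set_pmf p \<Longrightarrow> finite (set_pmf (S x))"
  shows "measure_pmf.expectation (bind_pmf p S) f
       = measure_pmf.expectation p (\<lambda>x. measure_pmf.expectation (S x) f)"
proof -
  show ?thesis
    by (subst pmf_expectation_bind[of "set_pmf p"])
       (auto simp: assms integral_measure_pmf[of "set_pmf p"])
qed

text \<open>Young's inequality: the two sides differ by exactly the square
  \<open>(x - l * y)^2 / l\<close>. The case \<open>l = 1\<close> is the usual doubling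
  bound.\<close>

lemma square_add_le_weighted:
  fixes x y l :: real
  assumes "l > 0"
  shows "(x + y)\<^sup>2 \<le> (1 + 1 / l) * x\<^sup>2 + (1 + l) * y\<^sup>2"
proof -
  have "0 \<le> (x - l * y)\<^sup>2 / l" using assms by simp
  also have "\<dots> = (1 + 1 / l) * x\<^sup>2 + (1 + l) * y\<^sup>2 - (x + y)\<^sup>2"
    using assms by (simp add: field_simps power2_eq_square)
  finally show ?thesis by simp
qed

section \<open>Chains with finitely supported laws, and the calculus of concentrated
  functions\<close>

locale finite_chain =
  fixes P :: "nat \<Rightarrow> 'g pmf" and S :: "'g \<Rightarrow> 'g pmf"
  assumes P_Suc: "P (Suc k) = bind_pmf (P k) S"
    and finite_P: "finite (set_pmf (P k))"
begin

abbreviation mean :: "nat \<Rightarrow> ('g \<Rightarrow> real) \<Rightarrow> real" where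
  "mean k \<equiv> measure_pmf.expectation (P k)"

text \<open>The constants \<open>M\<close> and \<open>K\<close> are uniform in the step number. The
  scale is \<open>Suc k\<close> rather than \<open>k\<close>, so that nothing is divided by zero at
  the start; it is comparable to the time up to a constant factor.\<close>

definition concentrated :: "(nat \<Rightarrow> 'g \<Rightarrow> real) \<Rightarrow> bool" where
  "concentrated f \<longleftrightarrow> (\<exists>M K. \<forall>k. (\<forall>G\<in>set_pmf (P k). \<bar>f k G\<bar> \<le> M) \<and>
     measure_pmf.variance (P k) (f k) \<le> K / real (Suc k))"

lemma integrable_P [simp]: "integrable (measure_pmf (P k)) (f :: 'g \<Rightarrow> real)"
  by (rule integrable_measure_pmf_finite[OF finite_P])

lemma finite_S:
  assumes "G \<in> set_pmf (P k)"
  shows "finite (set_pmf (S G))"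
  by (rule finite_subset[OF _ finite_P[of "Suc k"]]) (use assms in \<open>auto simp: P_Suc\<close>)

lemma concentrated_boundE:
  assumes "concentrated f"
  obtains M where "M \<ge> 0" "\<And>k G. G \<in> set_pmf (P k) \<Longrightarrow> \<bar>f k G\<bar> \<le> M"
    "\<And>k. \<bar>mean k (f k)\<bar> \<le> M"
proof -
  obtain M where M: "\<And>k G. G \<in> set_pmf (P k) \<Longrightarrow> \<bar>f k G\<bar> \<le> M"
    using assms unfolding concentrated_def by blast
  have "M \<ge> 0"
    using M[of _ 0] set_pmf_not_empty[of "P 0"] by force
  moreover have "\<bar>mean k (f k)\<bar> \<le> M" for k
    by (rule abs_expectation_le_pmf[OF finite_P M])
  ultimately show ?thesis using that M by metis
qed

lemma concentrated_varianceE: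
  assumes "concentrated f"
  obtains K where "K \<ge> 0" "\<And>k. mean k (\<lambda>G. (f k G - mean k (f k))\<^sup>2) \<le> K / real (Suc k)"
proof -
  obtain K where K: "\<And>k. mean k (\<lambda>G. (f k G - mean k (f k))\<^sup>2) \<le> K / real (Suc k)"
    using assms unfolding concentrated_def by blast
  have "0 \<le> mean 0 (\<lambda>G. (f 0 G - mean 0 (f 0))\<^sup>2)"
    by (rule integral_nonneg_AE) simp
  then have "0 \<le> K / real (Suc 0)" using K by (rule order_trans)
  then have "K \<ge> 0" by simp
  with K that show ?thesis by metis
qed

text \<open>The mean minimises the second moment, so any deterministic centre \<open>c k\<close>
  will do. This avoids computing the mean of a product, an inverse or a ratio.\<close>

lemma concentratedI:
  assumes M: "\<And>k G. G \<in> set_pmf (P k) \<Longrightarrow> \<bar>f k G\<bar> \<le> M"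
    and K: "\<And>k. mean k (\<lambda>G. (f k G - c k)\<^sup>2) \<le> K / real (Suc k)"
  shows "concentrated f"
  unfolding concentrated_def
proof (rule exI[of _ M], rule exI[of _ K], intro allI conjI ballI M)
  show "measure_pmf.variance (P k) (f k) \<le> K / real (Suc k)" for k
    by (rule order_trans[OF variance_le_second_moment[OF finite_P] K])
qed

text \<open>Squaring the pointwise bound and averaging transfers the two variance bounds to
  \<open>h\<close>. Closure under sums, products and inverses then reduces to finding a centre
  \<open>c\<close> and a Lipschitz constant \<open>L\<close>.\<close>

lemma concentrated_dominated:
  assumes f: "concentrated f" and g: "concentrated g"
    and M: "\<And>k G. G \<in> set_pmf (P k) \<Longrightarrow> \<bar>h k G\<bar> \<le> M"
    and L: "\<And>k G. G \<in> set_pmf (P k) \<Longrightarrow>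
      \<bar>h k G - c k\<bar> \<le> L * (\<bar>f k G - mean k (f k)\<bar> + \<bar>g k G - mean k (g k)\<bar>)"
  shows "concentrated h"
proof -
  obtain K where "K \<ge> 0" and K: "\<And>k. mean k (\<lambda>G. (f k G - mean k (f k))\<^sup>2) \<le> K / real (Suc k)"
    by (rule concentrated_varianceE[OF f]) (rule that)
  obtain K' where "K' \<ge> 0" and K': "\<And>k. mean k (\<lambda>G. (g k G - mean k (g k))\<^sup>2) \<le> K' / real (Suc k)"
    by (rule concentrated_varianceE[OF g]) (rule that)
  show ?thesis
  proof (rule concentratedI[where f = h and c = c, OF M])
    fix k
    have "mean k (\<lambda>G. (h k G - c k)\<^sup>2) \<le>
        mean k (\<lambda>G. 2 * L\<^sup>2 * (f k G - mean k (f k))\<^sup>2 + 2 * L\<^sup>2 * (g k G - mean k (g k))\<^sup>2)"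
    proof (rule expectation_mono_pmf[OF finite_P])
      fix G assume G: "G \<in> set_pmf (P k)"
      let ?x = "\<bar>f k G - mean k (f k)\<bar>" and ?y = "\<bar>g k G - mean k (g k)\<bar>"
      have "(h k G - c k)\<^sup>2 \<le> (L * (?x + ?y))\<^sup>2"
        using power_mono[OF L[OF G], of 2] by simp
      also have "\<dots> = L\<^sup>2 * (?x + ?y)\<^sup>2" by (simp add: power_mult_distrib)
      also have "\<dots> \<le> L\<^sup>2 * (2 * ?x\<^sup>2 + 2 * ?y\<^sup>2)"
        using sum_squares_bound[of ?x ?y] by (intro mult_left_mono) (auto simp: power2_sum)
      finally show "(h k G - c k)\<^sup>2 \<le> 2 * L\<^sup>2 * (f k G - mean k (f k))\<^sup>2 + 2 * L\<^sup>2 * (g k G - mean k (g k))\<^sup>2"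
        by (simp add: algebra_simps)
    qed
    also have "\<dots> = 2 * L\<^sup>2 * mean k (\<lambda>G. (f k G - mean k (f k))\<^sup>2) + 2 * L\<^sup>2 * mean k (\<lambda>G. (g k G - mean k (g k))\<^sup>2)"
      by simp
    also have "\<dots> \<le> 2 * L\<^sup>2 * (K / real (Suc k)) + 2 * L\<^sup>2 * (K' / real (Suc k))"
      by (intro add_mono mult_left_mono K K') auto
    also have "\<dots> = (2 * L\<^sup>2 * K + 2 * L\<^sup>2 * K') / real (Suc k)"
      by (simp add: add_divide_distrib)
    finally show "mean k (\<lambda>G. (h k G - c k)\<^sup>2) \<le> (2 * L\<^sup>2 * K + 2 * L\<^sup>2 * K') / real (Suc k)" .
  qed
qed

lemma concentrated_cong:
  assumes "\<And>k G. G \<in> set_pmf (P k) \<Longrightarrow> f k G = g k G"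
  shows "concentrated f \<longleftrightarrow> concentrated g"
proof -
  have "mean k (f k) = mean k (g k)" for k
    by (intro integral_cong_AE) (auto simp: AE_measure_pmf_iff assms)
  then have "measure_pmf.variance (P k) (f k) = measure_pmf.variance (P k) (g k)" for k
    by (intro integral_cong_AE) (auto simp: AE_measure_pmf_iff assms)
  then show ?thesis by (simp add: concentrated_def assms)
qed

text \<open>The square of such a function is already \<open>O(1/t)\<close> pointwise, so centre 0
  works and nothing about its fluctuations has to be known.\<close>

lemma concentrated_small:
  assumes "\<And>k G. G \<in> set_pmf (P k) \<Longrightarrow> \<bar>f k G\<bar> \<le> M / real (Suc k)"
  shows "concentrated f"
proof (rule concentratedI[where f = f and c = "\<lambda>_. 0"])
  have M: "M \<ge> 0"
    using assms[of _ 0] set_pmf_not_empty[of "P 0"] by force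
  fix k
  have le: "M / real (Suc k) \<le> M" using M by (simp add: divide_le_eq mult_le_cancel_left1)
  show "\<bar>f k G\<bar> \<le> M" if "G \<in> set_pmf (P k)" for G
    using assms[OF that] le by simp
  have "mean k (\<lambda>G. (f k G - 0)\<^sup>2) \<le> mean k (\<lambda>_. M\<^sup>2 / real (Suc k))"
  proof (rule expectation_mono_pmf[OF finite_P])
    fix G assume G: "G \<in> set_pmf (P k)"
    have "(f k G - 0)\<^sup>2 = \<bar>f k G\<bar> * \<bar>f k G\<bar>" by (simp add: power2_eq_square)
    also have "\<dots> \<le> M * (M / real (Suc k))"
      using assms[OF G] le by (intro mult_mono) (auto simp: M)
    finally show "(f k G - 0)\<^sup>2 \<le> M\<^sup>2 / real (Suc k)" by (simp add: power2_eq_square)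
  qed
  then show "mean k (\<lambda>G. (f k G - 0)\<^sup>2) \<le> M\<^sup>2 / real (Suc k)" by simp
qed

lemma concentrated_const:
  assumes "\<And>k. \<bar>c k\<bar> \<le> M"
  shows "concentrated (\<lambda>k G. c k)"
  by (rule concentratedI[where c = c and K = 0, OF assms]) simp

lemma concentrated_add:
  assumes f: "concentrated f" and g: "concentrated g"
  shows "concentrated (\<lambda>k G. f k G + g k G)"
proof -
  obtain M where "M \<ge> 0" and M: "\<And>k G. G \<in> set_pmf (P k) \<Longrightarrow> \<bar>f k G\<bar> \<le> M"
    and "\<And>k. \<bar>mean k (f k)\<bar> \<le> M"
    by (rule concentrated_boundE[OF f]) (rule that)
  obtain M' where "M' \<ge> 0" and M': "\<And>k G. G \<in> set_pmf (P k) \<Longrightarrow> \<bar>g k G\<bar> \<le> M'"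
    and "\<And>k. \<bar>mean k (g k)\<bar> \<le> M'"
    by (rule concentrated_boundE[OF g]) (rule that)
  show ?thesis
  proof (rule concentrated_dominated[OF f g])
    show "\<bar>f k G + g k G\<bar> \<le> M + M'" if "G \<in> set_pmf (P k)" for k G
      using M[OF that] M'[OF that] by simp
    show "\<bar>f k G + g k G - (mean k (f k) + mean k (g k))\<bar>
        \<le> 1 * (\<bar>f k G - mean k (f k)\<bar> + \<bar>g k G - mean k (g k)\<bar>)" for k G
      by simp
  qed
qed

lemma concentrated_mult:
  assumes f: "concentrated f" and g: "concentrated g"
  shows "concentrated (\<lambda>k G. f k G * g k G)"
proof -
  obtain M where M: "M \<ge> 0" "\<And>k G. G \<in> set_pmf (P k) \<Longrightarrow> \<bar>f k G\<bar> \<le> M"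
    "\<And>k. \<bar>mean k (f k)\<bar> \<le> M"
    by (rule concentrated_boundE[OF f]) (rule that)
  obtain M' where M': "M' \<ge> 0" "\<And>k G. G \<in> set_pmf (P k) \<Longrightarrow> \<bar>g k G\<bar> \<le> M'" "\<And>k. \<bar>mean k (g k)\<bar> \<le> M'"
    by (rule concentrated_boundE[OF g]) (rule that)
  show ?thesis
  proof (rule concentrated_dominated[OF f g])
    fix k G assume G: "G \<in> set_pmf (P k)"
    show "\<bar>f k G * g k G\<bar> \<le> M * M'"
      using M(2)[OF G] M'(2)[OF G] M(1) by (auto simp: abs_mult intro: mult_mono)
    \<comment> \<open>The product is changed one factor at a time; the factors left in front are a
      mean and a bounded function.\<close>
    have "f k G * g k G - mean k (f k) * mean k (g k)
        = mean k (g k) * (f k G - mean k (f k)) + f k G * (g k G - mean k (g k))"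
      by (simp add: algebra_simps)
    also have "\<bar>\<dots>\<bar> \<le> \<bar>mean k (g k)\<bar> * \<bar>f k G - mean k (f k)\<bar> + \<bar>f k G\<bar> * \<bar>g k G - mean k (g k)\<bar>"
      by (metis abs_mult abs_triangle_ineq)
    also have "\<dots> \<le> (M + M') * \<bar>f k G - mean k (f k)\<bar> + (M + M') * \<bar>g k G - mean k (g k)\<bar>"
      using M M' G by (intro add_mono mult_right_mono) (auto intro: add_increasing add_increasing2)
    finally show "\<bar>f k G * g k G - mean k (f k) * mean k (g k)\<bar>
        \<le> (M + M') * (\<bar>f k G - mean k (f k)\<bar> + \<bar>g k G - mean k (g k)\<bar>)"
      by (simp add: algebra_simps)
  qed
qed

lemma concentrated_cmult:
  assumes "concentrated f"
  shows "concentrated (\<lambda>k G. c * f k G)"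
  using concentrated_mult[OF concentrated_const[of "\<lambda>_. c" "\<bar>c\<bar>"] assms] by simp

text \<open>On \<open>[m, \<infinity>)\<close> the inverse is Lipschitz with constant
  \<open>1 / m^2\<close>, and the mean of \<open>f\<close> lies in the same interval. The function
  \<open>f\<close> simply fills both slots of the domination lemma.\<close>

lemma concentrated_inverse:
  assumes f: "concentrated f" and m: "m > 0" "\<And>k G. G \<in> set_pmf (P k) \<Longrightarrow> m \<le> f k G"
  shows "concentrated (\<lambda>k G. inverse (f k G))"
proof (rule concentrated_dominated[OF f f])
  fix k G assume G: "G \<in> set_pmf (P k)"
  have m': "m \<le> mean k (f k)"
    using expectation_mono_pmf[OF finite_P, of k "\<lambda>_. m" "f k"] m(2) by simp
  show "\<bar>inverse (f k G)\<bar> \<le> inverse m"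
    using m(2)[OF G] m(1) by (simp add: le_imp_inverse_le)
  have "inverse (f k G) - inverse (mean k (f k))
      = - (inverse (f k G) * (f k G - mean k (f k)) * inverse (mean k (f k)))"
    using m(2)[OF G] m(1) m' by (intro division_ring_inverse_diff[THEN trans]) (auto simp: algebra_simps)
  also have "\<bar>\<dots>\<bar> = inverse (f k G) * inverse (mean k (f k)) * \<bar>f k G - mean k (f k)\<bar>"
    using m(2)[OF G] m(1) m' by (simp add: abs_mult)
  also have "\<dots> \<le> inverse m * inverse m * \<bar>f k G - mean k (f k)\<bar>"
    using m(2)[OF G] m(1) m' by (intro mult_mono le_imp_inverse_le) auto
  also have "\<dots> \<le> inverse m * inverse m * (\<bar>f k G - mean k (f k)\<bar> + \<bar>f k G - mean k (f k)\<bar>)"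
    using m by (intro mult_left_mono) auto
  finally show "\<bar>inverse (f k G) - inverse (mean k (f k))\<bar>
      \<le> inverse m * inverse m * (\<bar>f k G - mean k (f k)\<bar> + \<bar>f k G - mean k (f k)\<bar>)" .
qed


text \<open>One step contracts the variance of \<open>F\<close> through the drift \<open>- A F\<close> and adds a constant, up to a
  cross term with \<open>R\<close>; the weight \<open>l\<close> in \<open>square_add_le_weighted\<close> is chosen
  proportional to the time, so that this cross term is bounded as well.\<close>

lemma concentrated_recursion:
  assumes A: "concentrated A" and R: "concentrated R"
    and A_nonneg: "\<And>k G. G \<in> set_pmf (P k) \<Longrightarrow> 0 \<le> A k G"
    and M: "\<And>k G. G \<in> set_pmf (P k) \<Longrightarrow> \<bar>F G\<bar> \<le> M * real (Suc k)"
    and C: "\<And>k G H. G \<in> set_pmf (P k) \<Longrightarrow> H \<in> set_pmf (S G) \<Longrightarrow> \<bar>F H - F G\<bar> \<le> C"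
    and drift: "\<And>k G. G \<in> set_pmf (P k) \<Longrightarrow>
      measure_pmf.expectation (S G) F = F G - A k G * (F G / real (Suc k)) + R k G"
  shows "concentrated (\<lambda>k G. F G / real (Suc k))"
proof -
  obtain MA where "MA \<ge> 0" and "\<And>k G. G \<in> set_pmf (P k) \<Longrightarrow> \<bar>A k G\<bar> \<le> MA"
    and MA: "\<And>k. \<bar>mean k (A k)\<bar> \<le> MA"
    by (rule concentrated_boundE[OF A]) (rule that)
  obtain KA where KA0: "KA \<ge> 0" and KA: "\<And>k. mean k (\<lambda>G. (A k G - mean k (A k))\<^sup>2) \<le> KA / real (Suc k)"
    by (rule concentrated_varianceE[OF A]) (rule that)
  obtain KR where KR0: "KR \<ge> 0" and KR: "\<And>k. mean k (\<lambda>G. (R k G - mean k (R k))\<^sup>2) \<le> KR / real (Suc k)"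
    by (rule concentrated_varianceE[OF R]) (rule that)
  define a where "a k = mean k (A k)" for k
  define \<rho> where "\<rho> k = mean k (R k)" for k
  define \<mu> where "\<mu> k = mean k F" for k
  define V where "V k = mean k (\<lambda>G. (F G - \<mu> k)\<^sup>2)" for k
  \<comment> \<open>With the deterministic \<open>a k\<close> in place of \<open>A k G\<close>, the
    drift reads \<open>(1 - a k / Suc k) * F + Q\<close>: all randomness of the coefficient sits in
    \<open>Q\<close>. The centre used for \<open>Q\<close> is \<open>\<rho> k\<close>, the mean of
    \<open>R\<close>, which need not be the mean of \<open>Q\<close>.\<close>
  define Q where "Q k G = R k G - (A k G - a k) * (F G / real (Suc k))" for k G
  define K where "K = 2 * KR + 2 * M\<^sup>2 * KA"
  have K0: "K \<ge> 0" using KA0 KR0 by (simp add: K_def)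
  have M0: "M \<ge> 0"
    using M[of _ 0] set_pmf_not_empty[of "P 0"] by force
  have a0: "0 \<le> a k" for k
    unfolding a_def by (rule integral_nonneg_AE) (simp add: AE_measure_pmf_iff A_nonneg)
  have Q: "mean k (\<lambda>G. (Q k G - \<rho> k)\<^sup>2) \<le> K / real (Suc k)" for k
  proof -
    have "mean k (\<lambda>G. (Q k G - \<rho> k)\<^sup>2)
        \<le> mean k (\<lambda>G. 2 * (R k G - \<rho> k)\<^sup>2 + 2 * M\<^sup>2 * (A k G - a k)\<^sup>2)"
    proof (rule expectation_mono_pmf[OF finite_P])
      fix G assume G: "G \<in> set_pmf (P k)"
      have "\<bar>F G / real (Suc k)\<bar> \<le> M"
        using M[OF G] by (simp add: divide_le_eq)
      then have "((A k G - a k) * (F G / real (Suc k)))\<^sup>2 \<le> (A k G - a k)\<^sup>2 * M\<^sup>2"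
        unfolding power_mult_distrib by (intro mult_left_mono) (auto simp flip: abs_le_square_iff simp: M0)
      moreover have "(Q k G - \<rho> k)\<^sup>2
          \<le> 2 * (R k G - \<rho> k)\<^sup>2 + 2 * ((A k G - a k) * (F G / real (Suc k)))\<^sup>2"
        using square_add_le_weighted[of 1 "R k G - \<rho> k" "- ((A k G - a k) * (F G / real (Suc k)))"]
        by (simp add: Q_def algebra_simps)
      ultimately show "(Q k G - \<rho> k)\<^sup>2 \<le> 2 * (R k G - \<rho> k)\<^sup>2 + 2 * M\<^sup>2 * (A k G - a k)\<^sup>2"
        by (simp add: mult.commute mult.left_commute)
    qed
    also have "\<dots> = 2 * mean k (\<lambda>G. (R k G - \<rho> k)\<^sup>2) + 2 * M\<^sup>2 * mean k (\<lambda>G. (A k G - a k)\<^sup>2)"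
      by simp
    also have "\<dots> \<le> 2 * (KR / real (Suc k)) + 2 * M\<^sup>2 * (KA / real (Suc k))"
      unfolding \<rho>_def a_def by (intro add_mono mult_left_mono KR KA) auto
    also have "\<dots> = K / real (Suc k)"
      by (simp add: K_def add_divide_distrib)
    finally show ?thesis .
  qed
  \<comment> \<open>The condition \<open>MA \<le> Suc k\<close> puts the multiplier
    \<open>1 - a k / Suc k\<close> into \<open>[0, 1]\<close>. The three terms are the noise of the
    step itself, the contracted old variance and the remainder.\<close>
  have step: "V (Suc k) \<le> C\<^sup>2 + (1 + 1 / l) * V k + (1 + l) * (K / real (Suc k))"
    if l: "l > 0" and k: "MA \<le> real (Suc k)" for k l
  proof -
    \<comment> \<open>The affine drift evaluated at the centres of \<open>F\<close> and
      \<open>Q\<close>; subtracting it from the conditional mean leaves only centred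
      quantities.\<close>
    define c where "c = (1 - a k / real (Suc k)) * \<mu> k + \<rho> k"
    have "V (Suc k) \<le> mean (Suc k) (\<lambda>H. (F H - c)\<^sup>2)"
      unfolding V_def \<mu>_def by (rule variance_le_second_moment[OF finite_P])
    also have "\<dots> = mean k (\<lambda>G. measure_pmf.expectation (S G) (\<lambda>H. (F H - c)\<^sup>2))"
      unfolding P_Suc by (rule expectation_bind_pmf[OF finite_P finite_S])
    also have "\<dots> \<le> mean k (\<lambda>G. C\<^sup>2 + (1 + 1 / l) * (F G - \<mu> k)\<^sup>2 + (1 + l) * (Q k G - \<rho> k)\<^sup>2)"
    proof (rule expectation_mono_pmf[OF finite_P])
      fix G assume G: "G \<in> set_pmf (P k)"
      note fin = finite_S[OF G]
      let ?m = "measure_pmf.expectation (S G) F"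
      have "measure_pmf.variance (S G) F \<le> measure_pmf.expectation (S G) (\<lambda>H. (F H - F G)\<^sup>2)"
        by (rule variance_le_second_moment[OF fin])
      also have "\<dots> \<le> measure_pmf.expectation (S G) (\<lambda>_. C\<^sup>2)"
        using C[OF G] by (intro expectation_mono_pmf[OF fin]) (metis abs_ge_zero power2_abs power_mono)
      finally have var: "measure_pmf.variance (S G) F \<le> C\<^sup>2" by simp
      have le: "(1 - a k / real (Suc k))\<^sup>2 \<le> 1"
        using a0[of k] MA[of k] k by (auto simp: abs_square_le_1 a_def[symmetric] field_simps)
      have "?m - c = (1 - a k / real (Suc k)) * (F G - \<mu> k) + (Q k G - \<rho> k)"
        by (simp add: drift[OF G] c_def Q_def algebra_simps diff_divide_distrib add_divide_distrib)
      then have "(?m - c)\<^sup>2 \<le> (1 + 1 / l) * ((1 - a k / real (Suc k)) * (F G - \<mu> k))\<^sup>2 + (1 + l) * (Q k G - \<rho> k)\<^sup>2"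
        by (simp only: square_add_le_weighted[OF l])
      also have "\<dots> \<le> (1 + 1 / l) * (1 * (F G - \<mu> k)\<^sup>2) + (1 + l) * (Q k G - \<rho> k)\<^sup>2"
        unfolding power_mult_distrib using l le by (intro add_mono mult_left_mono mult_right_mono) auto
      finally show "measure_pmf.expectation (S G) (\<lambda>H. (F H - c)\<^sup>2)
          \<le> C\<^sup>2 + (1 + 1 / l) * (F G - \<mu> k)\<^sup>2 + (1 + l) * (Q k G - \<rho> k)\<^sup>2"
        using var by (subst second_moment_pmf[OF fin]) linarith
    qed
    also have "\<dots> = C\<^sup>2 + (1 + 1 / l) * V k + (1 + l) * mean k (\<lambda>G. (Q k G - \<rho> k)\<^sup>2)"
      by (simp add: V_def)
    also have "\<dots> \<le> C\<^sup>2 + (1 + 1 / l) * V k + (1 + l) * (K / real (Suc k))"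
      using l by (intro add_left_mono mult_left_mono Q) auto
    finally show ?thesis .
  qed
  \<comment> \<open>Up to \<open>k1\<close> the multiplier is not under control, and the crude bound
    on \<open>F\<close> is used instead.\<close>
  define k1 where "k1 = nat \<lceil>MA\<rceil>"
  \<comment> \<open>The summand with \<open>M\<close> gives \<open>V k \<le> b^2\<close> at the
    early times; the others make \<open>b * (C^2 + 1 + 2 * K) \<le> b^2\<close>, which closes the
    induction.\<close>
  define b where "b = C\<^sup>2 + 1 + 2 * K + M * real (Suc k1)"
  have b: "b \<ge> 1" "b \<ge> M * real (Suc k1)" "b \<ge> C\<^sup>2 + 1 + 2 * K"
    using K0 M0 by (auto simp: b_def)
  have small: "V k \<le> b\<^sup>2 * real (Suc k)" if "k \<le> k1" for k
  proof -
    have "V k \<le> mean k (\<lambda>G. (F G - 0)\<^sup>2)"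
      unfolding V_def \<mu>_def by (rule variance_le_second_moment[OF finite_P])
    also have "\<dots> \<le> mean k (\<lambda>_. b\<^sup>2)"
    proof (rule expectation_mono_pmf[OF finite_P])
      fix G assume G: "G \<in> set_pmf (P k)"
      have "\<bar>F G\<bar> \<le> M * real (Suc k)" by (rule M[OF G])
      also have "\<dots> \<le> M * real (Suc k1)" using that M0 by (intro mult_left_mono) auto
      also have "\<dots> \<le> b" by (rule b)
      finally show "(F G - 0)\<^sup>2 \<le> b\<^sup>2" using b(1) by (simp flip: abs_le_square_iff)
    qed
    also have "\<dots> = b\<^sup>2" by simp
    also have "\<dots> \<le> b\<^sup>2 * real (Suc k)" using mult_left_mono[of 1 "real (Suc k)" "b\<^sup>2"] by simp
    finally show ?thesis .
  qed
  have V: "V k \<le> b\<^sup>2 * real (Suc k)" for k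
  proof (induction k)
    case 0
    show ?case by (rule small) simp
  next
    case (Suc k)
    show ?case
    proof (cases "Suc k \<le> k1")
      case False
      define s where "s = real (Suc k)"
      have s: "s \<ge> 1" by (simp add: s_def)
      have "MA \<le> s" using False by (simp add: k1_def s_def) linarith
      \<comment> \<open>The choice \<open>l = b * s\<close> turns the inductive bound
        \<open>b^2 * s\<close> into \<open>b^2 * s + b\<close> and the remainder into
        \<open>K / s + b * K\<close>. The total growth is at most \<open>b^2\<close>, exactly what
        the bound gains when \<open>s\<close> grows by 1.\<close>
      then have "V (Suc k) \<le> C\<^sup>2 + (1 + 1 / (b * s)) * V k + (1 + b * s) * (K / s)"
        using step[of "b * s" k] b(1) s by (simp add: s_def)
      also have "\<dots> \<le> C\<^sup>2 + (1 + 1 / (b * s)) * (b\<^sup>2 * s) + (1 + b * s) * (K / s)"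
        using Suc b(1) s by (intro add_mono mult_left_mono) (auto simp: s_def)
      also have "\<dots> = b\<^sup>2 * s + (C\<^sup>2 + b + K / s + b * K)"
        using b(1) s by (simp add: field_simps power2_eq_square)
      also have "\<dots> \<le> b\<^sup>2 * s + (b * C\<^sup>2 + b + b * K + b * K)"
      proof -
        have "C\<^sup>2 \<le> b * C\<^sup>2" using b(1) by (simp add: mult_le_cancel_right1)
        moreover have "K / s \<le> K"
          using s K0 mult_left_mono[of 1 s K] by (simp add: divide_le_eq)
        moreover have "K \<le> b * K"
          using b(1) K0 mult_right_mono[of 1 b K] by simp
        ultimately show ?thesis by linarith
      qed
      also have "\<dots> = b\<^sup>2 * s + b * (C\<^sup>2 + 1 + 2 * K)" by (simp add: algebra_simps)
      also have "\<dots> \<le> b\<^sup>2 * s + b * b" using b by (intro add_left_mono mult_left_mono) auto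
      also have "\<dots> = b\<^sup>2 * real (Suc (Suc k))" by (simp add: s_def power2_eq_square algebra_simps)
      finally show ?thesis .
    qed (rule small)
  qed
  show ?thesis
  proof (rule concentratedI)
    show "\<bar>F G / real (Suc k)\<bar> \<le> M" if "G \<in> set_pmf (P k)" for k G
      using M[OF that] by (simp add: divide_le_eq)
    fix k
    have "mean k (\<lambda>G. (F G / real (Suc k) - \<mu> k / real (Suc k))\<^sup>2)
        = mean k (\<lambda>G. (F G - \<mu> k)\<^sup>2 / (real (Suc k))\<^sup>2)"
      by (simp only: diff_divide_distrib[symmetric] power_divide)
    also have "\<dots> = V k / (real (Suc k))\<^sup>2" by (simp add: V_def)
    also have "\<dots> \<le> b\<^sup>2 * real (Suc k) / (real (Suc k))\<^sup>2"
      by (intro divide_right_mono V) simp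
    also have "\<dots> = b\<^sup>2 / real (Suc k)" by (simp add: power2_eq_square)
    finally show "mean k (\<lambda>G. (F G / real (Suc k) - \<mu> k / real (Suc k))\<^sup>2) \<le> b\<^sup>2 / real (Suc k)" .
  qed
qed

end

section \<open>One step of the random graph\<close>

lemma real_card_filter:
  assumes "finite A"
  shows "real (card {x \<in> A. Q x}) = (\<Sum>x\<in>A. of_bool (Q x))"
proof -
  have "{x \<in> A. Q x} = A \<inter> {x. Q x}" by auto
  then show ?thesis by (simp add: sum_of_bool_eq assms)
qed

lemma abs_card_diff_le:
  assumes "finite A" "finite B" "finite D" "A \<subseteq> B \<union> D" "B \<subseteq> A \<union> D" "card D \<le> c"
  shows "\<bar>real (card A) - real (card B)\<bar> \<le> real c"
proof -
  have "card A \<le> card B + card D"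
    using card_mono[OF _ assms(4)] assms card_Un_le[of B D] by simp
  moreover have "card B \<le> card A + card D"
    using card_mono[OF _ assms(5)] assms card_Un_le[of A D] by simp
  ultimately show ?thesis using assms(6) by linarith
qed

text \<open>The expected indicator that a vertex of degree \<open>d\<close> has degree \<open>j\<close> after one step, if a vertex of
  degree \<open>n\<close> is picked with probability \<open>r n\<close>.\<close>

definition shifted_indicator :: "(nat \<Rightarrow> real) \<Rightarrow> nat \<Rightarrow> nat \<Rightarrow> real" where
  "shifted_indicator r d j = of_bool (d = j) * (1 - r j) + (case j of 0 \<Rightarrow> 0 | Suc i \<Rightarrow> of_bool (d = i) * r i)"

text \<open>The degree of \<open>x\<close> changes only if \<open>x\<close> itself is picked, so the
  sum differs from a constant multiple of the total mass 1 in the single term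
  \<open>w = x\<close>.\<close>

lemma sum_shifted_indicator:
  fixes d :: "'v \<Rightarrow> nat" and r :: "nat \<Rightarrow> real"
  assumes "finite V" "x \<in> V" "(\<Sum>w\<in>V. r (d w)) = 1"
  shows "(\<Sum>w\<in>V. r (d w) * of_bool (d x + of_bool (x = w) = j)) = shifted_indicator r (d x) j"
proof -
  have "(\<Sum>w\<in>V. r (d w) * of_bool (d x + of_bool (x = w) = j))
      = (\<Sum>w\<in>V. of_bool (d x = j) * r (d w)
          + (if w = x then r (d x) * (of_bool (Suc (d x) = j) - of_bool (d x = j)) else 0))"
    by (intro sum.cong) (auto simp: algebra_simps)
  also have "\<dots> = of_bool (d x = j) * (\<Sum>w\<in>V. r (d w))
      + r (d x) * (of_bool (Suc (d x) = j) - of_bool (d x = j))"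
    using assms(1,2) by (simp add: sum.distrib sum_distrib_left[symmetric])
  also have "\<dots> = shifted_indicator r (d x) j"
    by (auto simp: assms(3) shifted_indicator_def split: nat.split)
  finally show ?thesis .
qed

definition in_count :: "nat \<Rightarrow> ('v, 'e) pre_digraph \<Rightarrow> nat" where
  "in_count j G = card {x \<in> verts G. in_degree G x = j}"

definition out_count :: "nat \<Rightarrow> ('v, 'e) pre_digraph \<Rightarrow> nat" where
  "out_count i G = card {x \<in> verts G. out_degree G x = i}"

section \<open>Effect of one new arc on degrees and counts\<close>

context
  fixes G :: "('v::infinite, 'e::infinite) pre_digraph"
  assumes fin: "fin_digraph G"
begin

interpretation fin_digraph G by (rule fin)

lemma fresh_arc: "fresh (arcs G) \<notin> arcs G"
  by (rule fresh_notin) simp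

lemma fresh_vert: "fresh (verts G) \<notin> verts G"
  by (rule fresh_notin) simp

lemma in_degree_attach_arc:
  "in_degree (attach_arc v w G) x = in_degree G x + of_bool (x = w)"
proof -
  have "in_arcs (attach_arc v w G) x = (if x = w then insert (fresh (arcs G)) (in_arcs G x) else in_arcs G x)"
    using fresh_arc by (auto simp: in_arcs_def attach_arc_def Let_def)
  then show ?thesis
    using fresh_arc by (auto simp: in_degree_def in_arcs_def)
qed

lemma out_degree_attach_arc:
  "out_degree (attach_arc v w G) x = out_degree G x + of_bool (x = v)"
proof -
  have "out_arcs (attach_arc v w G) x = (if x = v then insert (fresh (arcs G)) (out_arcs G x) else out_arcs G x)"
    using fresh_arc by (auto simp: out_arcs_def attach_arc_def Let_def)
  then show ?thesis
    using fresh_arc by (auto simp: out_degree_def out_arcs_def)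
qed

lemma verts_attach_arc: "verts (attach_arc v w G) = verts G \<union> {v, w}"
  by (simp add: attach_arc_def Let_def)

text \<open>The degree functions are total, and all endpoints of arcs lie in \<open>verts G\<close>.
  A new vertex can therefore be treated as one of degree 0 that was there before.\<close>

lemma degree_fresh: "in_degree G (fresh (verts G)) = 0" "out_degree G (fresh (verts G)) = 0"
proof -
  have "in_arcs G (fresh (verts G)) = {}" "out_arcs G (fresh (verts G)) = {}"
    using fresh_vert by (auto simp: in_arcs_def out_arcs_def) (metis head_in_verts tail_in_verts)+
  then show "in_degree G (fresh (verts G)) = 0" "out_degree G (fresh (verts G)) = 0"
    by (simp_all add: in_degree_def out_degree_def)
qed

lemma in_count_sum: "real (in_count j G) = (\<Sum>x\<in>verts G. of_bool (in_degree G x = j))"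
  by (simp add: in_count_def real_card_filter)

lemma out_count_sum: "real (out_count j G) = (\<Sum>x\<in>verts G. of_bool (out_degree G x = j))"
  by (simp add: out_count_def real_card_filter)

lemma in_count_attach_arc:
  "real (in_count j (attach_arc v w G)) =
    (\<Sum>x\<in>verts G \<union> {v, w}. of_bool (in_degree G x + of_bool (x = w) = j))"
  unfolding in_count_def in_degree_attach_arc verts_attach_arc by (rule real_card_filter) simp

lemma out_count_attach_arc:
  "real (out_count j (attach_arc v w G)) =
    (\<Sum>x\<in>verts G \<union> {v, w}. of_bool (out_degree G x + of_bool (x = v) = j))"
  unfolding out_count_def out_degree_attach_arc verts_attach_arc by (rule real_card_filter) simp

text \<open>The condition on an arc is split into a tail factor, a head factor and a non-loop factor
  so that the first two can later be averaged over independent picks.\<close>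

lemma edge_count_sum:
  "real (edge_count i j G) = (\<Sum>e\<in>arcs G. of_bool (out_degree G (tail G e) = i) *
     of_bool (in_degree G (head G e) = j) * of_bool (tail G e \<noteq> head G e))"
  by (simp add: edge_count_def real_card_filter of_bool_conj mult.assoc)

lemma edge_count_attach_arc:
  "real (edge_count i j (attach_arc v w G)) =
     (\<Sum>e\<in>arcs G. of_bool (out_degree G (tail G e) + of_bool (tail G e = v) = i) *
        of_bool (in_degree G (head G e) + of_bool (head G e = w) = j) * of_bool (tail G e \<noteq> head G e))
     + of_bool (Suc (out_degree G v) = i) * of_bool (Suc (in_degree G w) = j) * of_bool (v \<noteq> w)"
proof -
  let ?G = "attach_arc v w G" and ?a = "fresh (arcs G)"
  have arcs: "arcs ?G = insert ?a (arcs G)"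
    and ends: "tail ?G = (tail G)(?a := v)" "head ?G = (head G)(?a := w)"
    by (simp_all add: attach_arc_def Let_def)
  have "real (edge_count i j ?G) = (\<Sum>e\<in>arcs ?G. of_bool (out_degree ?G (tail ?G e) = i) *
     of_bool (in_degree ?G (head ?G e) = j) * of_bool (tail ?G e \<noteq> head ?G e))"
    unfolding edge_count_def of_bool_conj[symmetric] conj_assoc by (rule real_card_filter) (simp add: arcs)
  also have "\<dots> = (\<Sum>e\<in>arcs G. of_bool (out_degree ?G (tail ?G e) = i) *
     of_bool (in_degree ?G (head ?G e) = j) * of_bool (tail ?G e \<noteq> head ?G e))
     + of_bool (out_degree ?G v = i) * of_bool (in_degree ?G w = j) * of_bool (v \<noteq> w)"
    using fresh_arc by (simp add: arcs ends)
  also have "(\<Sum>e\<in>arcs G. of_bool (out_degree ?G (tail ?G e) = i) *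
     of_bool (in_degree ?G (head ?G e) = j) * of_bool (tail ?G e \<noteq> head ?G e) :: real) =
     (\<Sum>e\<in>arcs G. of_bool (out_degree G (tail G e) + of_bool (tail G e = v) = i) *
        of_bool (in_degree G (head G e) + of_bool (head G e = w) = j) * of_bool (tail G e \<noteq> head G e))"
    using fresh_arc by (intro sum.cong) (auto simp: ends out_degree_attach_arc in_degree_attach_arc)
  finally show ?thesis by (simp add: out_degree_attach_arc in_degree_attach_arc)
qed

lemma in_count_attach_arc_diff:
  "\<bar>real (in_count j (attach_arc v w G)) - real (in_count j G)\<bar> \<le> 2"
proof -
  have "card {v, w} \<le> 2" by (simp add: card_insert_if)
  then have "\<bar>real (in_count j (attach_arc v w G)) - real (in_count j G)\<bar> \<le> real 2"
    unfolding in_count_def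
    by (intro abs_card_diff_le[of _ _ "{v, w}"]) (auto simp: verts_attach_arc in_degree_attach_arc)
  then show ?thesis by simp
qed

lemma out_count_attach_arc_diff:
  "\<bar>real (out_count j (attach_arc v w G)) - real (out_count j G)\<bar> \<le> 2"
proof -
  have "card {v, w} \<le> 2" by (simp add: card_insert_if)
  then have "\<bar>real (out_count j (attach_arc v w G)) - real (out_count j G)\<bar> \<le> real 2"
    unfolding out_count_def
    by (intro abs_card_diff_le[of _ _ "{v, w}"]) (auto simp: verts_attach_arc out_degree_attach_arc)
  then show ?thesis by simp
qed

lemma edge_count_attach_arc_diff:
  "\<bar>real (edge_count i j (attach_arc v w G)) - real (edge_count i j G)\<bar> \<le> real (2 * i + 2 * j + 1)"
proof -
  let ?G = "attach_arc v w G" and ?a = "fresh (arcs G)"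
  have arcs: "arcs ?G = insert ?a (arcs G)"
    and ends: "tail ?G = (tail G)(?a := v)" "head ?G = (head G)(?a := w)"
    by (simp_all add: attach_arc_def Let_def)
  have fin': "fin_digraph ?G" by (rule attach_arc_invariant[OF fin])
  have card_in: "card {e \<in> in_arcs H x. in_degree H x = n} \<le> n" for H :: "('v, 'e) pre_digraph" and x n
    by (cases "in_degree H x = n") (auto simp: in_degree_def in_arcs_def)
  have card_out: "card {e \<in> out_arcs H x. out_degree H x = n} \<le> n" for H :: "('v, 'e) pre_digraph" and x n
    by (cases "out_degree H x = n") (auto simp: out_degree_def out_arcs_def)
  \<comment> \<open>Besides the new arc, an arc can enter or leave the class only if it starts at
    \<open>v\<close> or ends at \<open>w\<close>. It has to belong to the class before or after the
    step, and then the degree of that endpoint is \<open>i\<close> or \<open>j\<close> at that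
    moment; otherwise the set concerned is empty. This gives
    \<open>1 + 2 * i + 2 * j\<close>.\<close>
  define In where "In = {e \<in> in_arcs G w. in_degree G w = j}"
  define In' where "In' = {e \<in> in_arcs ?G w. in_degree ?G w = j}"
  define Out where "Out = {e \<in> out_arcs G v. out_degree G v = i}"
  define Out' where "Out' = {e \<in> out_arcs ?G v. out_degree ?G v = i}"
  let ?D = "{?a} \<union> (In \<union> In' \<union> (Out \<union> Out'))"
  have "card ?D \<le> 1 + ((j + j) + (i + i))"
    using card_in card_out unfolding In_def In'_def Out_def Out'_def
    by (intro order_trans[OF card_Un_le] add_mono) auto
  then have D: "card ?D \<le> 2 * i + 2 * j + 1" by simp
  show ?thesis
    unfolding edge_count_def
  proof (rule abs_card_diff_le[OF _ _ _ _ _ D])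
    show "finite {e \<in> arcs ?G. out_degree ?G (tail ?G e) = i \<and> in_degree ?G (head ?G e) = j \<and> tail ?G e \<noteq> head ?G e}"
      by (simp add: arcs)
    show "finite ?D"
      by (auto simp: In_def In'_def Out_def Out'_def in_arcs_def out_arcs_def arcs)
    show "{e \<in> arcs ?G. out_degree ?G (tail ?G e) = i \<and> in_degree ?G (head ?G e) = j \<and> tail ?G e \<noteq> head ?G e}
      \<subseteq> {e \<in> arcs G. out_degree G (tail G e) = i \<and> in_degree G (head G e) = j \<and> tail G e \<noteq> head G e} \<union> ?D"
    proof
      fix e assume e: "e \<in> {e \<in> arcs ?G. out_degree ?G (tail ?G e) = i \<and> in_degree ?G (head ?G e) = j \<and> tail ?G e \<noteq> head ?G e}"
      consider "e = ?a" | "e \<in> In'" | "e \<in> Out'" | "e \<in> arcs G" "e \<noteq> ?a" "head G e \<noteq> w" "tail G e \<noteq> v"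
        using e by (cases "e = ?a") (auto simp: arcs ends In'_def Out'_def in_arcs_def out_arcs_def)
      then show "e \<in> {e \<in> arcs G. out_degree G (tail G e) = i \<and> in_degree G (head G e) = j \<and> tail G e \<noteq> head G e} \<union> ?D"
        by cases (use e in \<open>auto simp: ends out_degree_attach_arc in_degree_attach_arc\<close>)
    qed
    show "{e \<in> arcs G. out_degree G (tail G e) = i \<and> in_degree G (head G e) = j \<and> tail G e \<noteq> head G e}
      \<subseteq> {e \<in> arcs ?G. out_degree ?G (tail ?G e) = i \<and> in_degree ?G (head ?G e) = j \<and> tail ?G e \<noteq> head ?G e} \<union> ?D"
    proof
      fix e assume e: "e \<in> {e \<in> arcs G. out_degree G (tail G e) = i \<and> in_degree G (head G e) = j \<and> tail G e \<noteq> head G e}"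
      then have ne: "e \<noteq> ?a" using fresh_arc by auto
      consider "e \<in> In" | "e \<in> Out" | "head G e \<noteq> w" "tail G e \<noteq> v"
        using e by (auto simp: In_def Out_def in_arcs_def out_arcs_def)
      then show "e \<in> {e \<in> arcs ?G. out_degree ?G (tail ?G e) = i \<and> in_degree ?G (head ?G e) = j \<and> tail ?G e \<noteq> head ?G e} \<union> ?D"
        by cases (use e ne in \<open>auto simp: arcs ends out_degree_attach_arc in_degree_attach_arc\<close>)
    qed
  qed simp
qed

lemma degree_count_le: "in_count j G \<le> card (verts G)" "out_count j G \<le> card (verts G)"
  unfolding in_count_def out_count_def by (auto intro!: card_mono)

lemma edge_count_le: "edge_count i j G \<le> card (arcs G)"
  unfolding edge_count_def by (auto intro!: card_mono)

text \<open>Every arc contributes to the out-degree of its own tail and the in-degree of its own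
  head. This is the base of the double induction.\<close>

lemma edge_count_0: "edge_count 0 j G = 0" "edge_count i 0 G = 0"
proof -
  have "out_degree G (tail G e) \<noteq> 0" "in_degree G (head G e) \<noteq> 0" if "e \<in> arcs G" for e
    using that by (auto simp: out_degree_def in_degree_def out_arcs_def in_arcs_def)
  then show "edge_count 0 j G = 0" "edge_count i 0 G = 0"
    by (auto simp: edge_count_def)
qed

end

text \<open>Only the factor \<open>b\<close> depends on the picked vertex, so averaging over the
  pick can be done arc by arc.\<close>

lemma sum_weighted:
  fixes p :: "'v \<Rightarrow> real"
  shows "(\<Sum>w\<in>V. p w * (\<Sum>e\<in>E. a e * b e w * c e)) = (\<Sum>e\<in>E. a e * (\<Sum>w\<in>V. p w * b e w) * c e)"
  unfolding sum_distrib_left sum_distrib_right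
  by (subst sum.swap) (simp add: ac_simps)

section \<open>Conditional expectations over one step\<close>

locale scale_free =
  fixes \<alpha> \<beta> \<gamma> \<delta>in \<delta>out :: real
  assumes params: "\<alpha> > 0" "\<beta> > 0" "\<gamma> > 0" "\<alpha> + \<beta> + \<gamma> = 1" "\<delta>in > 0" "\<delta>out > 0"
begin

abbreviation step :: "('v::infinite, 'e::infinite) pre_digraph \<Rightarrow> ('v, 'e) pre_digraph pmf" where
  "step \<equiv> graph_step \<alpha> \<beta> \<gamma> \<delta>in \<delta>out"

definition in_norm :: "('v, 'e) pre_digraph \<Rightarrow> real" where
  "in_norm G = real (card (arcs G)) + \<delta>in * real (card (verts G))"

definition out_norm :: "('v, 'e) pre_digraph \<Rightarrow> real" where
  "out_norm G = real (card (arcs G)) + \<delta>out * real (card (verts G))"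

text \<open>The argument is a degree, not a vertex, so the value is a common factor for a whole
  degree class and makes sense even if that class is empty.\<close>

definition in_prob :: "('v, 'e) pre_digraph \<Rightarrow> nat \<Rightarrow> real" where
  "in_prob G j = (real j + \<delta>in) / in_norm G"

definition out_prob :: "('v, 'e) pre_digraph \<Rightarrow> nat \<Rightarrow> real" where
  "out_prob G i = (real i + \<delta>out) / out_norm G"

context
  fixes G :: "('v::infinite, 'e::infinite) pre_digraph"
  assumes fin: "fin_digraph G" and ne: "verts G \<noteq> {}"
begin

interpretation fin_digraph G by (rule fin)

lemma norm_pos: "in_norm G > 0" "out_norm G > 0"
proof -
  have "card (verts G) > 0" using ne by (simp add: card_gt_0_iff)
  then show "in_norm G > 0" "out_norm G > 0"
    using params by (auto simp: in_norm_def out_norm_def intro!: add_nonneg_pos)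
qed

lemma sum_in_prob: "(\<Sum>w\<in>verts G. in_prob G (in_degree G w)) = 1"
proof -
  have "(\<Sum>w\<in>verts G. real (in_degree G w)) = real (card (arcs G))"
    using sum_in_degree[OF fin] by (metis of_nat_sum)
  then have "(\<Sum>w\<in>verts G. in_prob G (in_degree G w)) = in_norm G / in_norm G"
    by (simp add: in_prob_def sum_divide_distrib[symmetric] sum.distrib in_norm_def mult.commute)
  then show ?thesis using norm_pos by simp
qed

lemma sum_out_prob: "(\<Sum>w\<in>verts G. out_prob G (out_degree G w)) = 1"
proof -
  have "(\<Sum>w\<in>verts G. real (out_degree G w)) = real (card (arcs G))"
    using sum_out_degree[OF fin] by (metis of_nat_sum)
  then have "(\<Sum>w\<in>verts G. out_prob G (out_degree G w)) = out_norm G / out_norm G"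
    by (simp add: out_prob_def sum_divide_distrib[symmetric] sum.distrib out_norm_def mult.commute)
  then show ?thesis using norm_pos by simp
qed

lemma pmf_pick:
  "pmf (pick_by_in \<delta>in G) w = (if w \<in> verts G then in_prob G (in_degree G w) else 0)"
  "pmf (pick_by_out \<delta>out G) w = (if w \<in> verts G then out_prob G (out_degree G w) else 0)"
  using params fin ne
  by (simp_all add: pmf_pick_by_in pmf_pick_by_out in_prob_def out_prob_def in_norm_def out_norm_def)

lemma set_pick: "set_pmf (pick_by_in \<delta>in G) \<subseteq> verts G" "set_pmf (pick_by_out \<delta>out G) \<subseteq> verts G"
  by (auto simp: set_pmf_iff pmf_pick split: if_splits)

lemma finite_pick: "finite (set_pmf (pick_by_in \<delta>in G))" "finite (set_pmf (pick_by_out \<delta>out G))"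
  using set_pick by (auto intro: finite_subset)

text \<open>Both endpoints come from the old vertices and one and the same fresh name, hence at most
  one vertex is added.\<close>

lemma set_stepE:
  assumes "H \<in> set_pmf (step G)"
  obtains v w where "H = attach_arc v w G" "v \<in> insert (fresh (verts G)) (verts G)"
    "w \<in> insert (fresh (verts G)) (verts G)" "card (verts H) \<le> Suc (card (verts G))"
proof -
  from assms obtain v w where vw: "H = attach_arc v w G" "v \<in> insert (fresh (verts G)) (verts G)"
    "w \<in> insert (fresh (verts G)) (verts G)"
    unfolding graph_step_def set_bind_pmf
    by (elim UN_E, rename_tac k, case_tac k) (use set_pick in \<open>auto 4 4\<close>)
  moreover have "card (verts H) \<le> card (insert (fresh (verts G)) (verts G))"
    using vw by (intro card_mono) (auto simp: verts_attach_arc[OF fin])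
  ultimately show ?thesis
    using that fresh_vert[OF fin] by simp
qed

lemma finite_step: "finite (set_pmf (step G))"
proof -
  let ?V = "insert (fresh (verts G)) (verts G)"
  have "set_pmf (step G) \<subseteq> (\<lambda>(v, w). attach_arc v w G) ` (?V \<times> ?V)"
    by (auto elim!: set_stepE)
  then show ?thesis by (rule finite_subset) auto
qed

lemma expectation_pick:
  fixes f :: "'v \<Rightarrow> real"
  shows "measure_pmf.expectation (pick_by_in \<delta>in G) f = (\<Sum>w\<in>verts G. in_prob G (in_degree G w) * f w)"
    "measure_pmf.expectation (pick_by_out \<delta>out G) f = (\<Sum>v\<in>verts G. out_prob G (out_degree G v) * f v)"
proof -
  show "measure_pmf.expectation (pick_by_in \<delta>in G) f = (\<Sum>w\<in>verts G. in_prob G (in_degree G w) * f w)"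
    by (subst integral_measure_pmf[of "verts G"]) (use set_pick in \<open>auto simp: pmf_pick\<close>)
  show "measure_pmf.expectation (pick_by_out \<delta>out G) f = (\<Sum>v\<in>verts G. out_prob G (out_degree G v) * f v)"
    by (subst integral_measure_pmf[of "verts G"]) (use set_pick in \<open>auto simp: pmf_pick\<close>)
qed

lemma expectation_step:
  fixes f :: "('v, 'e) pre_digraph \<Rightarrow> real"
  shows "measure_pmf.expectation (step G) f =
      \<alpha> * (\<Sum>w\<in>verts G. in_prob G (in_degree G w) * f (attach_arc (fresh (verts G)) w G))
    + \<beta> * (\<Sum>v\<in>verts G. \<Sum>w\<in>verts G. out_prob G (out_degree G v) * (in_prob G (in_degree G w) * f (attach_arc v w G)))
    + \<gamma> * (\<Sum>v\<in>verts G. out_prob G (out_degree G v) * f (attach_arc v (fresh (verts G)) G))"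
proof -
  have U: "(UNIV :: step_kind set) = {New_Source, Internal, New_Target}"
    using step_kind.exhaust by auto
  let ?B = "\<lambda>k. case k of
       New_Source \<Rightarrow> do { w \<leftarrow> pick_by_in \<delta>in G; return_pmf (attach_arc (fresh (verts G)) w G) }
     | Internal \<Rightarrow> do { v \<leftarrow> pick_by_out \<delta>out G; w \<leftarrow> pick_by_in \<delta>in G; return_pmf (attach_arc v w G) }
     | New_Target \<Rightarrow> do { v \<leftarrow> pick_by_out \<delta>out G; return_pmf (attach_arc v (fresh (verts G)) G) }"
  have fin_U: "finite (UNIV :: step_kind set)" by (simp add: U)
  have fin_B: "finite (set_pmf (?B k))" for k
    using finite_pick by (cases k) auto
  have "measure_pmf.expectation (step G) f = (\<Sum>k\<in>UNIV. pmf (step_kind_pmf \<alpha> \<beta> \<gamma>) k *\<^sub>R measure_pmf.expectation (?B k) f)"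
    unfolding graph_step_def by (rule pmf_expectation_bind[OF fin_U fin_B]) simp
  also have "\<dots> = \<alpha> * measure_pmf.expectation (?B New_Source) f
      + \<beta> * measure_pmf.expectation (?B Internal) f + \<gamma> * measure_pmf.expectation (?B New_Target) f"
    using params by (simp add: U pmf_step_kind_pmf)
  finally show ?thesis
    using finite_pick
    by (simp add: expectation_bind_pmf expectation_pick sum_distrib_left)
qed

lemma expectation_step_eq:
  fixes f :: "('v, 'e) pre_digraph \<Rightarrow> real"
  assumes "\<And>w. w \<in> verts G \<Longrightarrow> f (attach_arc (fresh (verts G)) w G) = fs w"
    "\<And>v w. v \<in> verts G \<Longrightarrow> w \<in> verts G \<Longrightarrow> f (attach_arc v w G) = fi v w"
    "\<And>v. v \<in> verts G \<Longrightarrow> f (attach_arc v (fresh (verts G)) G) = ft v"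
  shows "measure_pmf.expectation (step G) f =
      \<alpha> * (\<Sum>w\<in>verts G. in_prob G (in_degree G w) * fs w)
    + \<beta> * (\<Sum>v\<in>verts G. \<Sum>w\<in>verts G. out_prob G (out_degree G v) * (in_prob G (in_degree G w) * fi v w))
    + \<gamma> * (\<Sum>v\<in>verts G. out_prob G (out_degree G v) * ft v)"
  unfolding expectation_step by (simp add: assms)

lemma expectation_card_verts:
  "measure_pmf.expectation (step G) (\<lambda>H. real (card (verts H))) = real (card (verts G)) + (\<alpha> + \<gamma>)"
proof -
  have "verts G \<union> {v, w} = verts G" if "v \<in> verts G" "w \<in> verts G" for v w
    using that by auto
  moreover have "card (verts G \<union> {fresh (verts G), w}) = Suc (card (verts G))"
    "card (verts G \<union> {w, fresh (verts G)}) = Suc (card (verts G))" if "w \<in> verts G" for w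
    using that fresh_vert[OF fin] by (simp_all add: insert_absorb)
  ultimately have "measure_pmf.expectation (step G) (\<lambda>H. real (card (verts H)))
      = \<alpha> * (\<Sum>w\<in>verts G. in_prob G (in_degree G w) * real (Suc (card (verts G))))
      + \<beta> * (\<Sum>v\<in>verts G. \<Sum>w\<in>verts G. out_prob G (out_degree G v) * (in_prob G (in_degree G w) * real (card (verts G))))
      + \<gamma> * (\<Sum>v\<in>verts G. out_prob G (out_degree G v) * real (Suc (card (verts G))))"
    by (intro expectation_step_eq) (simp_all only: verts_attach_arc[OF fin])
  also have "\<dots> = \<alpha> * ((\<Sum>w\<in>verts G. in_prob G (in_degree G w)) * real (Suc (card (verts G))))
      + \<beta> * ((\<Sum>v\<in>verts G. out_prob G (out_degree G v)) * ((\<Sum>w\<in>verts G. in_prob G (in_degree G w)) * real (card (verts G))))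
      + \<gamma> * ((\<Sum>v\<in>verts G. out_prob G (out_degree G v)) * real (Suc (card (verts G))))"
    unfolding sum_distrib_left[symmetric] sum_distrib_right[symmetric] ..
  also have "\<dots> = real (card (verts G)) * (\<alpha> + \<beta> + \<gamma>) + (\<alpha> + \<gamma>)"
    unfolding sum_in_prob sum_out_prob by (simp add: algebra_simps)
  finally show ?thesis using params by simp
qed

lemma sum_in_shift:
  assumes "x \<in> verts G"
  shows "(\<Sum>w\<in>verts G. in_prob G (in_degree G w) * of_bool (in_degree G x + of_bool (x = w) = j))
       = shifted_indicator (in_prob G) (in_degree G x) j"
  by (rule sum_shifted_indicator) (simp_all add: assms sum_in_prob)

lemma sum_out_shift:
  assumes "x \<in> verts G"
  shows "(\<Sum>v\<in>verts G. out_prob G (out_degree G v) * of_bool (out_degree G x + of_bool (x = v) = j))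
       = shifted_indicator (out_prob G) (out_degree G x) j"
  by (rule sum_shifted_indicator) (simp_all add: assms sum_out_prob)

lemma sum_shifted_in_degree:
  "(\<Sum>x\<in>verts G. shifted_indicator r (in_degree G x) j)
   = real (in_count j G) * (1 - r j) + (case j of 0 \<Rightarrow> 0 | Suc i \<Rightarrow> real (in_count i G) * r i)"
  by (simp add: shifted_indicator_def in_count_sum[OF fin] sum.distrib sum_distrib_right split: nat.split)

lemma sum_shifted_out_degree:
  "(\<Sum>x\<in>verts G. shifted_indicator r (out_degree G x) j)
   = real (out_count j G) * (1 - r j) + (case j of 0 \<Rightarrow> 0 | Suc i \<Rightarrow> real (out_count i G) * r i)"
  by (simp add: shifted_indicator_def out_count_sum[OF fin] sum.distrib sum_distrib_right split: nat.split)

text \<open>Heads are picked by in-degree in the \<open>New_Source\<close> and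
  \<open>Internal\<close> steps, hence the factor \<open>\<alpha> + \<beta>\<close>. A
  \<open>New_Target\<close> step leaves the old in-degrees alone. New vertices are born with
  in-degree 0 in a \<open>New_Source\<close> step and 1 in a \<open>New_Target\<close> step.\<close>

lemma expectation_in_count:
  "measure_pmf.expectation (step G) (\<lambda>H. real (in_count j H)) =
     real (in_count j G) - (\<alpha> + \<beta>) * in_prob G j * real (in_count j G)
     + (\<alpha> + \<beta>) * (case j of 0 \<Rightarrow> 0 | Suc i \<Rightarrow> in_prob G i * real (in_count i G))
     + (\<alpha> * of_bool (j = 0) + \<gamma> * of_bool (j = 1))"
proof -
  let ?V = "verts G" and ?u = "fresh (verts G)"
  let ?p = "\<lambda>w. in_prob G (in_degree G w)" and ?q = "\<lambda>v. out_prob G (out_degree G v)"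
  let ?I = "\<lambda>w. \<Sum>x\<in>?V. of_bool (in_degree G x + of_bool (x = w) = j) :: real"
  have u: "?u \<notin> ?V" by (rule fresh_vert[OF fin])
  have source: "real (in_count j (attach_arc ?u w G)) = ?I w + of_bool (j = 0)" if "w \<in> ?V" for w
  proof -
    have "?V \<union> {?u, w} = insert ?u ?V" "?u \<noteq> w" using that u by auto
    then show ?thesis using u by (auto simp: in_count_attach_arc[OF fin] degree_fresh[OF fin])
  qed
  have inner: "real (in_count j (attach_arc v w G)) = ?I w" if "v \<in> ?V" "w \<in> ?V" for v w
  proof -
    have "?V \<union> {v, w} = ?V" using that by auto
    then show ?thesis by (simp add: in_count_attach_arc[OF fin])
  qed
  have target: "real (in_count j (attach_arc v ?u G)) = real (in_count j G) + of_bool (j = 1)" if "v \<in> ?V" for v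
  proof -
    have V: "?V \<union> {v, ?u} = insert ?u ?V" using that by auto
    have S: "(\<Sum>x\<in>?V. of_bool (in_degree G x + of_bool (x = ?u) = j)) = real (in_count j G)"
      using u unfolding in_count_sum[OF fin] by (intro sum.cong) auto
    have "real (in_count j (attach_arc v ?u G))
        = of_bool (in_degree G ?u + of_bool (?u = ?u) = j) + (\<Sum>x\<in>?V. of_bool (in_degree G x + of_bool (x = ?u) = j))"
      unfolding in_count_attach_arc[OF fin] V by (rule sum.insert) (use u in auto)
    then show ?thesis unfolding S degree_fresh[OF fin] by auto
  qed
  have I: "(\<Sum>w\<in>?V. ?p w * ?I w) = real (in_count j G) * (1 - in_prob G j)
      + (case j of 0 \<Rightarrow> 0 | Suc i \<Rightarrow> real (in_count i G) * in_prob G i)"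
  proof -
    have "(\<Sum>w\<in>?V. ?p w * ?I w) = (\<Sum>x\<in>?V. \<Sum>w\<in>?V. ?p w * of_bool (in_degree G x + of_bool (x = w) = j))"
      unfolding sum_distrib_left by (rule sum.swap)
    also have "\<dots> = (\<Sum>x\<in>?V. shifted_indicator (in_prob G) (in_degree G x) j)"
      by (intro sum.cong refl sum_in_shift)
    finally show ?thesis by (simp add: sum_shifted_in_degree)
  qed
  have "measure_pmf.expectation (step G) (\<lambda>H. real (in_count j H)) =
      \<alpha> * (\<Sum>w\<in>?V. ?p w * (?I w + of_bool (j = 0)))
    + \<beta> * (\<Sum>v\<in>?V. \<Sum>w\<in>?V. ?q v * (?p w * ?I w))
    + \<gamma> * (\<Sum>v\<in>?V. ?q v * (real (in_count j G) + of_bool (j = 1)))"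
    by (intro expectation_step_eq source inner target)
  also have "\<dots> = \<alpha> * ((\<Sum>w\<in>?V. ?p w * ?I w) + (\<Sum>w\<in>?V. ?p w) * of_bool (j = 0))
    + \<beta> * ((\<Sum>v\<in>?V. ?q v) * (\<Sum>w\<in>?V. ?p w * ?I w))
    + \<gamma> * ((\<Sum>v\<in>?V. ?q v) * (real (in_count j G) + of_bool (j = 1)))"
    unfolding distrib_left sum.distrib sum_distrib_left[symmetric] sum_distrib_right[symmetric] by simp
  also have "\<dots> = \<alpha> * ((\<Sum>w\<in>?V. ?p w * ?I w) + of_bool (j = 0))
    + \<beta> * (\<Sum>w\<in>?V. ?p w * ?I w) + (1 - \<alpha> - \<beta>) * real (in_count j G) + \<gamma> * of_bool (j = 1)"
  proof -
    have "1 - \<alpha> - \<beta> = \<gamma>" using params(4) by simp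
    then show ?thesis unfolding sum_in_prob sum_out_prob mult_1_left by (simp only: distrib_left add.assoc)
  qed
  also have "\<dots> = real (in_count j G) - (\<alpha> + \<beta>) * in_prob G j * real (in_count j G)
     + (\<alpha> + \<beta>) * (case j of 0 \<Rightarrow> 0 | Suc i \<Rightarrow> in_prob G i * real (in_count i G))
     + (\<alpha> * of_bool (j = 0) + \<gamma> * of_bool (j = 1))"
    unfolding I by (cases j) (simp_all add: algebra_simps)
  finally show ?thesis .
qed

text \<open>The mirror image of the in-degree case under reversal of arcs, with
  \<open>\<alpha>\<close> and \<open>\<gamma>\<close> exchanged.\<close>

lemma expectation_out_count:
  "measure_pmf.expectation (step G) (\<lambda>H. real (out_count j H)) =
     real (out_count j G) - (\<beta> + \<gamma>) * out_prob G j * real (out_count j G)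
     + (\<beta> + \<gamma>) * (case j of 0 \<Rightarrow> 0 | Suc i \<Rightarrow> out_prob G i * real (out_count i G))
     + (\<gamma> * of_bool (j = 0) + \<alpha> * of_bool (j = 1))"
proof -
  let ?V = "verts G" and ?u = "fresh (verts G)"
  let ?p = "\<lambda>w. in_prob G (in_degree G w)" and ?q = "\<lambda>v. out_prob G (out_degree G v)"
  let ?O = "\<lambda>v. \<Sum>x\<in>?V. of_bool (out_degree G x + of_bool (x = v) = j) :: real"
  have u: "?u \<notin> ?V" by (rule fresh_vert[OF fin])
  have target: "real (out_count j (attach_arc v ?u G)) = ?O v + of_bool (j = 0)" if "v \<in> ?V" for v
  proof -
    have "?V \<union> {v, ?u} = insert ?u ?V" "?u \<noteq> v" using that u by auto
    then show ?thesis using u by (auto simp: out_count_attach_arc[OF fin] degree_fresh[OF fin])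
  qed
  have inner: "real (out_count j (attach_arc v w G)) = ?O v" if "v \<in> ?V" "w \<in> ?V" for v w
  proof -
    have "?V \<union> {v, w} = ?V" using that by auto
    then show ?thesis by (simp add: out_count_attach_arc[OF fin])
  qed
  have source: "real (out_count j (attach_arc ?u w G)) = real (out_count j G) + of_bool (j = 1)" if "w \<in> ?V" for w
  proof -
    have V: "?V \<union> {?u, w} = insert ?u ?V" using that by auto
    have S: "(\<Sum>x\<in>?V. of_bool (out_degree G x + of_bool (x = ?u) = j)) = real (out_count j G)"
      using u unfolding out_count_sum[OF fin] by (intro sum.cong) auto
    have "real (out_count j (attach_arc ?u w G))
        = of_bool (out_degree G ?u + of_bool (?u = ?u) = j) + (\<Sum>x\<in>?V. of_bool (out_degree G x + of_bool (x = ?u) = j))"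
      unfolding out_count_attach_arc[OF fin] V by (rule sum.insert) (use u in auto)
    then show ?thesis unfolding S degree_fresh[OF fin] by auto
  qed
  have O: "(\<Sum>v\<in>?V. ?q v * ?O v) = real (out_count j G) * (1 - out_prob G j)
      + (case j of 0 \<Rightarrow> 0 | Suc i \<Rightarrow> real (out_count i G) * out_prob G i)"
  proof -
    have "(\<Sum>v\<in>?V. ?q v * ?O v) = (\<Sum>x\<in>?V. \<Sum>v\<in>?V. ?q v * of_bool (out_degree G x + of_bool (x = v) = j))"
      unfolding sum_distrib_left by (rule sum.swap)
    also have "\<dots> = (\<Sum>x\<in>?V. shifted_indicator (out_prob G) (out_degree G x) j)"
      by (intro sum.cong refl sum_out_shift)
    finally show ?thesis by (simp add: sum_shifted_out_degree)
  qed
  have "measure_pmf.expectation (step G) (\<lambda>H. real (out_count j H)) =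
      \<alpha> * (\<Sum>w\<in>?V. ?p w * (real (out_count j G) + of_bool (j = 1)))
    + \<beta> * (\<Sum>v\<in>?V. \<Sum>w\<in>?V. ?q v * (?p w * ?O v))
    + \<gamma> * (\<Sum>v\<in>?V. ?q v * (?O v + of_bool (j = 0)))"
    by (intro expectation_step_eq source inner target)
  also have "\<dots> = \<alpha> * ((\<Sum>w\<in>?V. ?p w) * (real (out_count j G) + of_bool (j = 1)))
    + \<beta> * (\<Sum>v\<in>?V. ?q v * ((\<Sum>w\<in>?V. ?p w) * ?O v))
    + \<gamma> * ((\<Sum>v\<in>?V. ?q v * ?O v) + (\<Sum>v\<in>?V. ?q v) * of_bool (j = 0))"
    unfolding distrib_left sum.distrib sum_distrib_left[symmetric] sum_distrib_right[symmetric] by simp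
  also have "\<dots> = (1 - \<beta> - \<gamma>) * real (out_count j G) + \<alpha> * of_bool (j = 1)
    + \<beta> * (\<Sum>v\<in>?V. ?q v * ?O v) + \<gamma> * ((\<Sum>v\<in>?V. ?q v * ?O v) + of_bool (j = 0))"
  proof -
    have "1 - \<beta> - \<gamma> = \<alpha>" using params(4) by simp
    then show ?thesis unfolding sum_in_prob sum_out_prob mult_1_left by (simp only: distrib_left)
  qed
  also have "\<dots> = real (out_count j G) - (\<beta> + \<gamma>) * out_prob G j * real (out_count j G)
     + (\<beta> + \<gamma>) * (case j of 0 \<Rightarrow> 0 | Suc i \<Rightarrow> out_prob G i * real (out_count i G))
     + (\<gamma> * of_bool (j = 0) + \<alpha> * of_bool (j = 1))"
    unfolding O by (cases j) (simp_all add: algebra_simps)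
  finally show ?thesis .
qed

lemma shifted_indicator_Suc:
  "shifted_indicator r d (Suc j) = of_bool (d = Suc j) * (1 - r (Suc j)) + of_bool (d = j) * r j"
  by (simp add: shifted_indicator_def)

text \<open>In a \<open>New_Source\<close> step only heads of old arcs change degree, in a
  \<open>New_Target\<close> step only tails; in an \<open>Internal\<close> step both may change, and
  independence of the picks gives products of the one-sided factors. The new arc itself counts if
  its ends had degrees \<open>i\<close> and \<open>j\<close> before. A fresh end had degree 0, hence
  the terms with \<open>i = 0\<close> and \<open>j = 0\<close>; in an \<open>Internal\<close> step
  the pairs with \<open>v = w\<close> are subtracted, since loops do not count.\<close>

lemma expectation_edge_count:
  fixes i j :: nat
  defines "X \<equiv> \<lambda>a b. real (edge_count a b G)" and "r \<equiv> in_prob G" and "q \<equiv> out_prob G"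
  shows "measure_pmf.expectation (step G) (\<lambda>H. real (edge_count (Suc i) (Suc j) H)) =
     \<alpha> * ((1 - r (Suc j)) * X (Suc i) (Suc j) + r j * X (Suc i) j + of_bool (i = 0) * (r j * real (in_count j G)))
   + \<beta> * ((1 - q (Suc i)) * (1 - r (Suc j)) * X (Suc i) (Suc j) + (1 - q (Suc i)) * r j * X (Suc i) j
        + q i * (1 - r (Suc j)) * X i (Suc j) + q i * r j * X i j
        + q i * r j * (real (out_count i G) * real (in_count j G)
            - real (card {v \<in> verts G. out_degree G v = i \<and> in_degree G v = j})))
   + \<gamma> * ((1 - q (Suc i)) * X (Suc i) (Suc j) + q i * X i (Suc j) + of_bool (j = 0) * (q i * real (out_count i G)))"
proof -
  let ?V = "verts G" and ?E = "arcs G" and ?u = "fresh (verts G)"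
  let ?L = "real (card {v \<in> verts G. out_degree G v = i \<and> in_degree G v = j})"
  define p where "p w = in_prob G (in_degree G w)" for w
  define p' where "p' v = out_prob G (out_degree G v)" for v
  define T where "T e = (of_bool (out_degree G (tail G e) = Suc i) :: real)" for e
  define H where "H e = (of_bool (in_degree G (head G e) = Suc j) :: real)" for e
  \<comment> \<open>For the tail factor: \<open>T\<close> is before the step, \<open>T1\<close>
    after picking \<open>v\<close>, and \<open>T'\<close> the average of \<open>T1\<close> over the
    pick. Likewise \<open>H\<close>, \<open>H1\<close>, \<open>H'\<close> for heads.\<close>
  define T1 where "T1 e v = (of_bool (out_degree G (tail G e) + of_bool (tail G e = v) = Suc i) :: real)" for e v
  define H1 where "H1 e w = (of_bool (in_degree G (head G e) + of_bool (head G e = w) = Suc j) :: real)" for e w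
  define T' where "T' e = shifted_indicator q (out_degree G (tail G e)) (Suc i)" for e
  define H' where "H' e = shifted_indicator r (in_degree G (head G e)) (Suc j)" for e
  define nl where "nl e = (of_bool (tail G e \<noteq> head G e) :: real)" for e
  have u: "?u \<notin> ?V" by (rule fresh_vert[OF fin])
  have sum_p: "sum p ?V = 1" "sum p' ?V = 1"
    using sum_in_prob sum_out_prob by (simp_all add: p_def p'_def)
  have H1: "(\<Sum>w\<in>?V. p w * H1 e w) = H' e" if "e \<in> ?E" for e
    unfolding p_def H1_def H'_def r_def using that by (intro sum_in_shift) simp
  have T1: "(\<Sum>v\<in>?V. p' v * T1 e v) = T' e" if "e \<in> ?E" for e
    unfolding p'_def T1_def T'_def q_def using that by (intro sum_out_shift) simp
  have tail_u: "tail G e \<noteq> ?u" "head G e \<noteq> ?u" if "e \<in> ?E" for e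
    using that u by (metis tail_in_verts, metis head_in_verts)
  have T1_u: "T1 e ?u = T e" "H1 e ?u = H e" if "e \<in> ?E" for e
    using tail_u[OF that] by (simp_all add: T1_def T_def H1_def H_def)
  have attach: "real (edge_count (Suc i) (Suc j) (attach_arc v w G)) = (\<Sum>e\<in>?E. T1 e v * H1 e w * nl e)
      + of_bool (out_degree G v = i) * of_bool (in_degree G w = j) * of_bool (v \<noteq> w)" for v w
    unfolding edge_count_attach_arc[OF fin] T1_def H1_def nl_def by simp
  have source: "real (edge_count (Suc i) (Suc j) (attach_arc ?u w G))
      = (\<Sum>e\<in>?E. T e * H1 e w * nl e) + of_bool (i = 0) * of_bool (in_degree G w = j)" if "w \<in> ?V" for w
  proof -
    have "?u \<noteq> w" using that u by auto
    moreover have "(\<Sum>e\<in>?E. T1 e ?u * H1 e w * nl e) = (\<Sum>e\<in>?E. T e * H1 e w * nl e)"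
      by (intro sum.cong) (simp_all add: T1_u)
    ultimately show ?thesis unfolding attach by (auto simp: degree_fresh[OF fin])
  qed
  have target: "real (edge_count (Suc i) (Suc j) (attach_arc v ?u G))
      = (\<Sum>e\<in>?E. T1 e v * H e * nl e) + of_bool (j = 0) * of_bool (out_degree G v = i)" if "v \<in> ?V" for v
  proof -
    have "v \<noteq> ?u" using that u by auto
    moreover have "(\<Sum>e\<in>?E. T1 e v * H1 e ?u * nl e) = (\<Sum>e\<in>?E. T1 e v * H e * nl e)"
      by (intro sum.cong) (simp_all add: T1_u)
    ultimately show ?thesis unfolding attach by (auto simp: degree_fresh[OF fin])
  qed
  have new_head: "(\<Sum>w\<in>?V. p w * of_bool (in_degree G w = j)) = r j * real (in_count j G)"
    unfolding in_count_sum[OF fin] sum_distrib_left by (intro sum.cong) (auto simp: p_def r_def)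
  have new_tail: "(\<Sum>v\<in>?V. p' v * of_bool (out_degree G v = i)) = q i * real (out_count i G)"
    unfolding out_count_sum[OF fin] sum_distrib_left by (intro sum.cong) (auto simp: p'_def q_def)
  have new_arc: "(\<Sum>v\<in>?V. \<Sum>w\<in>?V. p' v * (p w * (of_bool (out_degree G v = i) * of_bool (in_degree G w = j) * of_bool (v \<noteq> w))))
      = q i * r j * (real (out_count i G) * real (in_count j G) - ?L)"
  proof -
    have "(\<Sum>w\<in>?V. p' v * (p w * (of_bool (out_degree G v = i) * of_bool (in_degree G w = j) * of_bool (v \<noteq> w))))
        = (p' v * of_bool (out_degree G v = i)) * (r j * real (in_count j G))
          - q i * r j * of_bool (out_degree G v = i \<and> in_degree G v = j)" if "v \<in> ?V" for v
    proof -
      have "(\<Sum>w\<in>?V. p' v * (p w * (of_bool (out_degree G v = i) * of_bool (in_degree G w = j) * of_bool (v \<noteq> w))))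
        = (\<Sum>w\<in>?V. (p' v * of_bool (out_degree G v = i)) * (p w * of_bool (in_degree G w = j))
            - (if w = v then q i * r j * of_bool (out_degree G v = i \<and> in_degree G v = j) else 0))"
        by (intro sum.cong) (auto simp: p_def p'_def q_def r_def)
      also have "\<dots> = (p' v * of_bool (out_degree G v = i)) * (\<Sum>w\<in>?V. p w * of_bool (in_degree G w = j))
            - q i * r j * of_bool (out_degree G v = i \<and> in_degree G v = j)"
        unfolding sum_subtractf sum_distrib_left[symmetric] using that by simp
      finally show ?thesis unfolding new_head .
    qed
    then have "(\<Sum>v\<in>?V. \<Sum>w\<in>?V. p' v * (p w * (of_bool (out_degree G v = i) * of_bool (in_degree G w = j) * of_bool (v \<noteq> w))))
      = (\<Sum>v\<in>?V. p' v * of_bool (out_degree G v = i)) * (r j * real (in_count j G))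
        - q i * r j * (\<Sum>v\<in>?V. of_bool (out_degree G v = i \<and> in_degree G v = j))"
      by (simp only: sum_subtractf sum_distrib_left sum_distrib_right cong: sum.cong)
    then show ?thesis
      unfolding new_tail real_card_filter[OF finite_verts, symmetric] by (simp add: algebra_simps)
  qed
  have A: "(\<Sum>w\<in>?V. p w * (\<Sum>e\<in>?E. T e * H1 e w * nl e)) = (\<Sum>e\<in>?E. T e * H' e * nl e)"
    unfolding sum_weighted by (intro sum.cong) (simp_all add: H1)
  \<comment> \<open>The head weight \<open>h\<close> is left open: it is \<open>H\<close> in a
    \<open>New_Target\<close> step and the averaged \<open>H'\<close> in an \<open>Internal\<close>
    step.\<close>
  have B: "(\<Sum>v\<in>?V. p' v * (\<Sum>e\<in>?E. T1 e v * (h e * nl e))) = (\<Sum>e\<in>?E. T' e * (h e * nl e))" for h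
    using sum_weighted[where p = p' and V = ?V and a = "\<lambda>_. 1" and b = T1 and c = "\<lambda>e. h e * nl e" and E = ?E] by (simp add: T1 cong: sum.cong)
  have C: "(\<Sum>v\<in>?V. \<Sum>w\<in>?V. p' v * (p w * (\<Sum>e\<in>?E. T1 e v * H1 e w * nl e))) = (\<Sum>e\<in>?E. T' e * (H' e * nl e))"
  proof -
    have "(\<Sum>w\<in>?V. p w * (\<Sum>e\<in>?E. T1 e v * H1 e w * nl e)) = (\<Sum>e\<in>?E. T1 e v * (H' e * nl e))" for v
      unfolding sum_weighted by (intro sum.cong) (simp_all add: H1)
    then show ?thesis by (simp add: sum_distrib_left[symmetric] B)
  qed
  have TH': "(\<Sum>e\<in>?E. T e * H' e * nl e) = (1 - r (Suc j)) * X (Suc i) (Suc j) + r j * X (Suc i) j"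
    unfolding X_def edge_count_sum[OF fin] H'_def T_def nl_def shifted_indicator_Suc sum_distrib_left sum.distrib[symmetric]
    by (intro sum.cong refl) (simp only: algebra_simps)
  have T'H: "(\<Sum>e\<in>?E. T' e * (H e * nl e)) = (1 - q (Suc i)) * X (Suc i) (Suc j) + q i * X i (Suc j)"
    unfolding X_def edge_count_sum[OF fin] T'_def H_def nl_def shifted_indicator_Suc sum_distrib_left sum.distrib[symmetric]
    by (intro sum.cong refl) (simp only: algebra_simps)
  have T'H': "(\<Sum>e\<in>?E. T' e * (H' e * nl e)) = (1 - q (Suc i)) * (1 - r (Suc j)) * X (Suc i) (Suc j)
      + (1 - q (Suc i)) * r j * X (Suc i) j + q i * (1 - r (Suc j)) * X i (Suc j) + q i * r j * X i j"
    unfolding X_def edge_count_sum[OF fin] T'_def H'_def nl_def shifted_indicator_Suc sum_distrib_left sum.distrib[symmetric]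
    by (intro sum.cong refl) (simp only: algebra_simps)
  have "measure_pmf.expectation (step G) (\<lambda>H. real (edge_count (Suc i) (Suc j) H)) =
      \<alpha> * (\<Sum>w\<in>?V. p w * ((\<Sum>e\<in>?E. T e * H1 e w * nl e) + of_bool (i = 0) * of_bool (in_degree G w = j)))
    + \<beta> * (\<Sum>v\<in>?V. \<Sum>w\<in>?V. p' v * (p w * ((\<Sum>e\<in>?E. T1 e v * H1 e w * nl e)
        + of_bool (out_degree G v = i) * of_bool (in_degree G w = j) * of_bool (v \<noteq> w))))
    + \<gamma> * (\<Sum>v\<in>?V. p' v * ((\<Sum>e\<in>?E. T1 e v * H e * nl e) + of_bool (j = 0) * of_bool (out_degree G v = i)))"
    unfolding p_def p'_def by (intro expectation_step_eq source attach target)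
  also have "(\<Sum>w\<in>?V. p w * ((\<Sum>e\<in>?E. T e * H1 e w * nl e) + of_bool (i = 0) * of_bool (in_degree G w = j)))
      = (\<Sum>e\<in>?E. T e * H' e * nl e) + of_bool (i = 0) * (r j * real (in_count j G))"
    unfolding A[symmetric] new_head[symmetric] distrib_left sum.distrib sum_distrib_left[of "of_bool (i = 0)"]
    by (simp only: mult.left_commute)
  also have "(\<Sum>v\<in>?V. \<Sum>w\<in>?V. p' v * (p w * ((\<Sum>e\<in>?E. T1 e v * H1 e w * nl e)
        + of_bool (out_degree G v = i) * of_bool (in_degree G w = j) * of_bool (v \<noteq> w))))
      = (\<Sum>e\<in>?E. T' e * (H' e * nl e)) + q i * r j * (real (out_count i G) * real (in_count j G) - ?L)"
    unfolding C[symmetric] new_arc[symmetric] distrib_left sum.distrib ..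
  also have "(\<Sum>v\<in>?V. p' v * ((\<Sum>e\<in>?E. T1 e v * H e * nl e) + of_bool (j = 0) * of_bool (out_degree G v = i)))
      = (\<Sum>e\<in>?E. T' e * (H e * nl e)) + of_bool (j = 0) * (q i * real (out_count i G))"
    unfolding B[symmetric] new_tail[symmetric] distrib_left sum.distrib sum_distrib_left[of "of_bool (j = 0)"]
    by (simp only: mult.left_commute mult.assoc)
  finally show ?thesis
    unfolding TH' T'H T'H' .
qed

end
end

section \<open>Linear variance of the edge counts\<close>

locale scale_free_process = scale_free +
  fixes G0 :: "('v::infinite, 'e::infinite) pre_digraph"
  assumes fin_G0: "fin_digraph G0" and ne_G0: "verts G0 \<noteq> {}"
begin

abbreviation law :: "nat \<Rightarrow> ('v, 'e) pre_digraph pmf" where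
  "law \<equiv> graph_after \<alpha> \<beta> \<gamma> \<delta>in \<delta>out G0"

lemma law_invariant:
  assumes "G \<in> set_pmf (law k)"
  shows "fin_digraph G" "verts G \<noteq> {}" "card (arcs G) = card (arcs G0) + k"
    "card (verts G) \<le> card (verts G0) + k"
proof -
  have "fin_digraph G \<and> verts G \<noteq> {} \<and> card (arcs G) = card (arcs G0) + k
      \<and> card (verts G) \<le> card (verts G0) + k"
    using assms
  proof (induction k arbitrary: G)
    case 0
    then show ?case using fin_G0 ne_G0 by simp
  next
    case (Suc k)
    then obtain H where H: "H \<in> set_pmf (law k)" "G \<in> set_pmf (step H)" by auto
    then have "fin_digraph H" "verts H \<noteq> {}" "card (arcs H) = card (arcs G0) + k"
      "card (verts H) \<le> card (verts G0) + k"
      using Suc.IH by auto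
    moreover from this have "card (verts G) \<le> Suc (card (verts H))"
      using H by (auto elim: set_stepE)
    ultimately show ?case using graph_step_invariant[of H G] H(2) by auto
  qed
  then show "fin_digraph G" "verts G \<noteq> {}" "card (arcs G) = card (arcs G0) + k"
    "card (verts G) \<le> card (verts G0) + k" by auto
qed

sublocale finite_chain law step
proof
  show "law (Suc k) = law k \<bind> step" for k by simp
  show "finite (set_pmf (law k))" for k
    by (induction k) (auto intro: finite_step[OF law_invariant(1,2)])
qed

lemma card_verts_bound:
  assumes "G \<in> set_pmf (law k)"
  shows "real (card (verts G)) \<le> real (card (verts G0) + 1) * real (Suc k)"
proof -
  have "real (card (verts G)) \<le> real (card (verts G0)) + real k"
    using law_invariant(4)[OF assms] by linarith
  also have "\<dots> \<le> real (card (verts G0) + 1) * real (Suc k)" by (simp add: algebra_simps)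
  finally show ?thesis .
qed

lemma edge_count_bound:
  assumes "G \<in> set_pmf (law k)"
  shows "real (edge_count i j G) \<le> real (card (arcs G0) + 1) * real (Suc k)"
proof -
  have "real (edge_count i j G) \<le> real (card (arcs G0)) + real k"
    using edge_count_le[OF law_invariant(1)[OF assms], of i j] law_invariant(3)[OF assms] by linarith
  also have "\<dots> \<le> real (card (arcs G0) + 1) * real (Suc k)" by (simp add: algebra_simps)
  finally show ?thesis .
qed

section \<open>Concentration of the normalising constants and degree counts\<close>

lemma concentrated_card_verts: "concentrated (\<lambda>k G. real (card (verts G)) / real (Suc k))"
proof (rule concentrated_recursion)
  show "concentrated (\<lambda>k G. 0)" by (rule concentrated_const[of _ 0]) simp
  show "concentrated (\<lambda>k G. \<alpha> + \<gamma>)" by (rule concentrated_const[of _ "\<bar>\<alpha> + \<gamma>\<bar>"]) simp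
  fix k and G :: "('v, 'e) pre_digraph" assume G: "G \<in> set_pmf (law k)"
  note inv = law_invariant[OF G]
  show "\<bar>real (card (verts G))\<bar> \<le> real (card (verts G0) + 1) * real (Suc k)"
    using card_verts_bound[OF G] by simp
  show "measure_pmf.expectation (step G) (\<lambda>H. real (card (verts H))) =
      real (card (verts G)) - 0 * (real (card (verts G)) / real (Suc k)) + (\<alpha> + \<gamma>)"
    by (simp add: expectation_card_verts[OF inv(1,2)])
  fix H assume "H \<in> set_pmf (step G)"
  then obtain v w where "H = attach_arc v w G" "card (verts H) \<le> Suc (card (verts G))"
    by (rule set_stepE[OF inv(1,2)])
  moreover from this have "card (verts G) \<le> card (verts H)"
    using inv(1) by (intro card_mono) (auto simp: verts_attach_arc fin_digraph.finite_verts)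
  ultimately show "\<bar>real (card (verts H)) - real (card (verts G))\<bar> \<le> 1" by linarith
qed simp_all

text \<open>After \<open>k\<close> steps the number of arcs is deterministic, so the denominator is
  random only through the number of vertices. It is at least \<open>k + \<delta>\<close>, since
  there is a vertex, and \<open>k + \<delta> \<ge> min 1 \<delta> * Suc k\<close> keeps the scaled
  denominator away from 0 even if \<open>G0\<close> has no arcs.\<close>

lemma concentrated_inverse_norm:
  assumes "\<delta> > 0"
  shows "concentrated (\<lambda>k G. real (Suc k) / (real (card (arcs G)) + \<delta> * real (card (verts G))))"
proof -
  let ?m = "min 1 \<delta>"
  let ?f = "\<lambda>k G. real (card (arcs G0) + k) / real (Suc k) + \<delta> * (real (card (verts G)) / real (Suc k))"
  have f: "?f k G = (real (card (arcs G)) + \<delta> * real (card (verts G))) / real (Suc k)"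
    if "G \<in> set_pmf (law k)" for k G
    using law_invariant(3)[OF that] by (simp add: add_divide_distrib)
  have "concentrated (\<lambda>k (G :: ('v, 'e) pre_digraph). real (card (arcs G0) + k) / real (Suc k))"
    by (rule concentrated_const[of _ "real (card (arcs G0) + 1)"]) (simp add: divide_le_eq algebra_simps)
  then have "concentrated ?f"
    by (intro concentrated_add concentrated_cmult concentrated_card_verts)
  moreover have "?m \<le> ?f k G" if G: "G \<in> set_pmf (law k)" for k G
  proof -
    have "card (verts G) \<ge> 1"
      using law_invariant(1,2)[OF G] by (simp add: Suc_le_eq card_gt_0_iff fin_digraph.finite_verts)
    then have "\<delta> * 1 \<le> \<delta> * real (card (verts G))"
      using assms by (intro mult_left_mono) auto
    moreover have "?m * real k \<le> 1 * real k" by (intro mult_right_mono) auto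
    moreover have "?m \<le> \<delta>" by simp
    ultimately have "?m * real (Suc k) \<le> real (card (arcs G)) + \<delta> * real (card (verts G))"
      using law_invariant(3)[OF G] by (simp add: algebra_simps)
    then show ?thesis unfolding f[OF G] by (simp add: le_divide_eq)
  qed
  ultimately have "concentrated (\<lambda>k G. inverse (?f k G))"
    using assms by (intro concentrated_inverse[of _ ?m]) auto
  then show ?thesis
    by (rule concentrated_cong[THEN iffD1, rotated]) (simp only: f inverse_divide)
qed

lemma concentrated_in_prob: "concentrated (\<lambda>k G. real (Suc k) * in_prob G j)"
  using concentrated_cmult[OF concentrated_inverse_norm, of \<delta>in "real j + \<delta>in"] params
  by (simp add: in_prob_def in_norm_def mult.commute)

lemma concentrated_out_prob: "concentrated (\<lambda>k G. real (Suc k) * out_prob G i)"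
  using concentrated_cmult[OF concentrated_inverse_norm, of \<delta>out "real i + \<delta>out"] params
  by (simp add: out_prob_def out_norm_def mult.commute)

lemma prob_nonneg:
  assumes "G \<in> set_pmf (law k)"
  shows "in_prob G j \<ge> 0" "out_prob G i \<ge> 0"
  using norm_pos[OF law_invariant(1,2)[OF assms]] params
  by (auto simp: in_prob_def out_prob_def intro!: divide_nonneg_pos)

text \<open>Each probability is \<open>O(1/t)\<close> and \<open>Y\<close> is \<open>O(t)\<close>,
  so the product is \<open>O(1/t)\<close>. A linear bound on \<open>Y\<close> replaces any knowledge
  of its fluctuations.\<close>

lemma concentrated_prob_prob_mult:
  assumes "\<And>k G. G \<in> set_pmf (law k) \<Longrightarrow> \<bar>Y G\<bar> \<le> M * real (Suc k)"
  shows "concentrated (\<lambda>k G. out_prob G i * in_prob G j * Y G)"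
proof -
  obtain Mo where Mo: "Mo \<ge> 0" "\<And>k G. G \<in> set_pmf (law k) \<Longrightarrow> \<bar>real (Suc k) * out_prob G i\<bar> \<le> Mo"
    "\<And>k. \<bar>mean k (\<lambda>G. real (Suc k) * out_prob G i)\<bar> \<le> Mo"
    by (rule concentrated_boundE[OF concentrated_out_prob]) (rule that)
  obtain Mi where Mi: "Mi \<ge> 0" "\<And>k G. G \<in> set_pmf (law k) \<Longrightarrow> \<bar>real (Suc k) * in_prob G j\<bar> \<le> Mi"
    "\<And>k. \<bar>mean k (\<lambda>G. real (Suc k) * in_prob G j)\<bar> \<le> Mi"
    by (rule concentrated_boundE[OF concentrated_in_prob]) (rule that)
  show ?thesis
  proof (rule concentrated_small)
    fix k G assume G: "G \<in> set_pmf (law k)"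
    let ?s = "real (Suc k)"
    have s: "?s > 0" by simp
    have "out_prob G i * in_prob G j * Y G = (?s * out_prob G i) * (?s * in_prob G j) * (Y G / ?s) / ?s"
      using s by (simp add: field_simps del: of_nat_Suc)
    also have "\<bar>\<dots>\<bar> = \<bar>?s * out_prob G i\<bar> * \<bar>?s * in_prob G j\<bar> * (\<bar>Y G\<bar> / ?s) / ?s"
      using s by (simp only: abs_mult abs_divide abs_of_pos)
    also have "\<dots> \<le> Mo * Mi * M / ?s"
      using Mo(1,2) Mi(1,2) G assms[OF G] s
      by (intro divide_right_mono mult_mono) (auto simp: divide_le_eq)
    finally show "\<bar>out_prob G i * in_prob G j * Y G\<bar> \<le> Mo * Mi * M / ?s" .
  qed
qed

text \<open>In-degrees grow by at most one per step. The inflow into class \<open>Suc j\<close>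
  therefore comes only from class \<open>j\<close> and from new vertices, so the induction
  hypothesis makes \<open>R\<close> concentrated.\<close>

lemma concentrated_in_count: "concentrated (\<lambda>k G. real (in_count j G) / real (Suc k))"
proof (induction j)
  case 0
  show ?case
  proof (rule concentrated_recursion)
    show "concentrated (\<lambda>k G. (\<alpha> + \<beta>) * (real (Suc k) * in_prob G 0))"
      by (intro concentrated_cmult concentrated_in_prob)
    show "concentrated (\<lambda>k G. \<alpha>)" by (rule concentrated_const[of _ "\<bar>\<alpha>\<bar>"]) simp
    fix k and G :: "('v, 'e) pre_digraph" assume G: "G \<in> set_pmf (law k)"
    note inv = law_invariant[OF G]
    show "0 \<le> (\<alpha> + \<beta>) * (real (Suc k) * in_prob G 0)"
      using prob_nonneg[OF G] params by simp
    show "\<bar>real (in_count 0 G)\<bar> \<le> real (card (verts G0) + 1) * real (Suc k)"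
      using card_verts_bound[OF G] degree_count_le(1)[OF inv(1), of 0] by simp
    show "measure_pmf.expectation (step G) (\<lambda>H. real (in_count 0 H)) = real (in_count 0 G)
        - (\<alpha> + \<beta>) * (real (Suc k) * in_prob G 0) * (real (in_count 0 G) / real (Suc k)) + \<alpha>"
      by (simp add: expectation_in_count[OF inv(1,2)] del: of_nat_Suc)
    fix H assume "H \<in> set_pmf (step G)"
    then show "\<bar>real (in_count 0 H) - real (in_count 0 G)\<bar> \<le> 2"
      by (rule set_stepE[OF inv(1,2)]) (use in_count_attach_arc_diff[OF inv(1)] in auto)
  qed
next
  case (Suc j)
  show ?case
  proof (rule concentrated_recursion)
    show "concentrated (\<lambda>k G. (\<alpha> + \<beta>) * (real (Suc k) * in_prob G (Suc j)))"
      by (intro concentrated_cmult concentrated_in_prob)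
    show "concentrated (\<lambda>k G. (\<alpha> + \<beta>) * ((real (Suc k) * in_prob G j) * (real (in_count j G) / real (Suc k)))
        + \<gamma> * of_bool (j = 0))"
      by (intro concentrated_add concentrated_cmult concentrated_mult concentrated_in_prob Suc
            concentrated_const[of _ "\<bar>\<gamma> * of_bool (j = 0)\<bar>"]) simp
    fix k and G :: "('v, 'e) pre_digraph" assume G: "G \<in> set_pmf (law k)"
    note inv = law_invariant[OF G]
    show "0 \<le> (\<alpha> + \<beta>) * (real (Suc k) * in_prob G (Suc j))"
      using prob_nonneg[OF G] params by simp
    show "\<bar>real (in_count (Suc j) G)\<bar> \<le> real (card (verts G0) + 1) * real (Suc k)"
      using card_verts_bound[OF G] degree_count_le(1)[OF inv(1), of "Suc j"] by simp
    show "measure_pmf.expectation (step G) (\<lambda>H. real (in_count (Suc j) H)) = real (in_count (Suc j) G)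
        - (\<alpha> + \<beta>) * (real (Suc k) * in_prob G (Suc j)) * (real (in_count (Suc j) G) / real (Suc k))
        + ((\<alpha> + \<beta>) * ((real (Suc k) * in_prob G j) * (real (in_count j G) / real (Suc k))) + \<gamma> * of_bool (j = 0))"
      by (simp add: expectation_in_count[OF inv(1,2)] del: of_nat_Suc)
    fix H assume "H \<in> set_pmf (step G)"
    then show "\<bar>real (in_count (Suc j) H) - real (in_count (Suc j) G)\<bar> \<le> 2"
      by (rule set_stepE[OF inv(1,2)]) (use in_count_attach_arc_diff[OF inv(1)] in auto)
  qed
qed

lemma concentrated_out_count: "concentrated (\<lambda>k G. real (out_count j G) / real (Suc k))"
proof (induction j)
  case 0
  show ?case
  proof (rule concentrated_recursion)
    show "concentrated (\<lambda>k G. (\<beta> + \<gamma>) * (real (Suc k) * out_prob G 0))"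
      by (intro concentrated_cmult concentrated_out_prob)
    show "concentrated (\<lambda>k G. \<gamma>)" by (rule concentrated_const[of _ "\<bar>\<gamma>\<bar>"]) simp
    fix k and G :: "('v, 'e) pre_digraph" assume G: "G \<in> set_pmf (law k)"
    note inv = law_invariant[OF G]
    show "0 \<le> (\<beta> + \<gamma>) * (real (Suc k) * out_prob G 0)"
      using prob_nonneg[OF G] params by simp
    show "\<bar>real (out_count 0 G)\<bar> \<le> real (card (verts G0) + 1) * real (Suc k)"
      using card_verts_bound[OF G] degree_count_le(2)[OF inv(1), of 0] by simp
    show "measure_pmf.expectation (step G) (\<lambda>H. real (out_count 0 H)) = real (out_count 0 G)
        - (\<beta> + \<gamma>) * (real (Suc k) * out_prob G 0) * (real (out_count 0 G) / real (Suc k)) + \<gamma>"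
      by (simp add: expectation_out_count[OF inv(1,2)] del: of_nat_Suc)
    fix H assume "H \<in> set_pmf (step G)"
    then show "\<bar>real (out_count 0 H) - real (out_count 0 G)\<bar> \<le> 2"
      by (rule set_stepE[OF inv(1,2)]) (use out_count_attach_arc_diff[OF inv(1)] in auto)
  qed
next
  case (Suc j)
  show ?case
  proof (rule concentrated_recursion)
    show "concentrated (\<lambda>k G. (\<beta> + \<gamma>) * (real (Suc k) * out_prob G (Suc j)))"
      by (intro concentrated_cmult concentrated_out_prob)
    show "concentrated (\<lambda>k G. (\<beta> + \<gamma>) * ((real (Suc k) * out_prob G j) * (real (out_count j G) / real (Suc k)))
        + \<alpha> * of_bool (j = 0))"
      by (intro concentrated_add concentrated_cmult concentrated_mult concentrated_out_prob Suc
            concentrated_const[of _ "\<bar>\<alpha> * of_bool (j = 0)\<bar>"]) simp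
    fix k and G :: "('v, 'e) pre_digraph" assume G: "G \<in> set_pmf (law k)"
    note inv = law_invariant[OF G]
    show "0 \<le> (\<beta> + \<gamma>) * (real (Suc k) * out_prob G (Suc j))"
      using prob_nonneg[OF G] params by simp
    show "\<bar>real (out_count (Suc j) G)\<bar> \<le> real (card (verts G0) + 1) * real (Suc k)"
      using card_verts_bound[OF G] degree_count_le(2)[OF inv(1), of "Suc j"] by simp
    show "measure_pmf.expectation (step G) (\<lambda>H. real (out_count (Suc j) H)) = real (out_count (Suc j) G)
        - (\<beta> + \<gamma>) * (real (Suc k) * out_prob G (Suc j)) * (real (out_count (Suc j) G) / real (Suc k))
        + ((\<beta> + \<gamma>) * ((real (Suc k) * out_prob G j) * (real (out_count j G) / real (Suc k))) + \<alpha> * of_bool (j = 0))"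
      by (simp add: expectation_out_count[OF inv(1,2)] del: of_nat_Suc)
    fix H assume "H \<in> set_pmf (step G)"
    then show "\<bar>real (out_count (Suc j) H) - real (out_count (Suc j) G)\<bar> \<le> 2"
      by (rule set_stepE[OF inv(1,2)]) (use out_count_attach_arc_diff[OF inv(1)] in auto)
  qed
qed

section \<open>Concentration of the edge counts\<close>

lemma concentrated_edge_count_Suc:
  assumes X1: "concentrated (\<lambda>k G. real (edge_count (Suc i) j G) / real (Suc k))"
    and X2: "concentrated (\<lambda>k G. real (edge_count i (Suc j) G) / real (Suc k))"
  shows "concentrated (\<lambda>k G. real (edge_count (Suc i) (Suc j) G) / real (Suc k))"
proof (rule concentrated_recursion)
  let ?X = "\<lambda>a b G. real (edge_count a b G)"
  let ?L = "\<lambda>G. real (card {v \<in> verts G. out_degree G v = i \<and> in_degree G v = j})"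
  \<comment> \<open>First-order loss from the class: the head is picked in a
    \<open>New_Source\<close> or \<open>Internal\<close> step, or the tail in an
    \<open>Internal\<close> or \<open>New_Target\<close> step.\<close>
  let ?A = "\<lambda>k G. (\<alpha> + \<beta>) * (real (Suc k) * in_prob G (Suc j)) + (\<beta> + \<gamma>) * (real (Suc k) * out_prob G (Suc i))"
  \<comment> \<open>The second-order terms of the \<open>Internal\<close> step: cross terms from
    expanding the products \<open>(1 - q) * (1 - r)\<close> and their kin, and the diagonal
    correction. They contain the count under study and the joint degree count, and are disposed of
    by size alone.\<close>
  let ?Z = "\<lambda>G. \<beta> * (out_prob G (Suc i) * in_prob G (Suc j) * ?X (Suc i) (Suc j) G)
    + (- \<beta>) * (out_prob G (Suc i) * in_prob G j * ?X (Suc i) j G)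
    + (- \<beta>) * (out_prob G i * in_prob G (Suc j) * ?X i (Suc j) G)
    + \<beta> * (out_prob G i * in_prob G j * ?X i j G) + (- \<beta>) * (out_prob G i * in_prob G j * ?L G)"
  let ?R = "\<lambda>k G. (\<alpha> + \<beta>) * ((real (Suc k) * in_prob G j) * (?X (Suc i) j G / real (Suc k)))
    + (\<beta> + \<gamma>) * ((real (Suc k) * out_prob G i) * (?X i (Suc j) G / real (Suc k)))
    + \<alpha> * of_bool (i = 0) * ((real (Suc k) * in_prob G j) * (real (in_count j G) / real (Suc k)))
    + \<gamma> * of_bool (j = 0) * ((real (Suc k) * out_prob G i) * (real (out_count i G) / real (Suc k)))
    + \<beta> * (((real (Suc k) * out_prob G i) * (real (out_count i G) / real (Suc k)))
        * ((real (Suc k) * in_prob G j) * (real (in_count j G) / real (Suc k))))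
    + ?Z G"
  have L: "?L G \<le> real (card (verts G0) + 1) * real (Suc k)" if G: "G \<in> set_pmf (law k)" for k G
  proof -
    have "?L G \<le> real (card (verts G))"
      using law_invariant(1)[OF G] by (auto intro!: card_mono simp: fin_digraph.finite_verts)
    then show ?thesis using card_verts_bound[OF G] by simp
  qed
  show "concentrated ?A"
    by (intro concentrated_add concentrated_cmult concentrated_in_prob concentrated_out_prob)
  have XZ: "concentrated (\<lambda>k G. out_prob G a * in_prob G b * ?X c d G)" for a b c d
    by (rule concentrated_prob_prob_mult[where M = "real (card (arcs G0) + 1)"])
      (use edge_count_bound in auto)
  have LZ: "concentrated (\<lambda>k G. out_prob G i * in_prob G j * ?L G)"
    by (rule concentrated_prob_prob_mult[where M = "real (card (verts G0) + 1)"]) (use L in auto)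
  have Z: "concentrated (\<lambda>k G. ?Z G)"
    by (intro concentrated_add concentrated_cmult XZ LZ)
  note head = concentrated_mult[OF concentrated_in_prob concentrated_in_count, of j j]
  note tail = concentrated_mult[OF concentrated_out_prob concentrated_out_count, of i i]
  have T1: "concentrated (\<lambda>k G. (\<alpha> + \<beta>) * ((real (Suc k) * in_prob G j) * (?X (Suc i) j G / real (Suc k))))"
    by (rule concentrated_cmult[OF concentrated_mult[OF concentrated_in_prob X1]])
  have T2: "concentrated (\<lambda>k G. (\<beta> + \<gamma>) * ((real (Suc k) * out_prob G i) * (?X i (Suc j) G / real (Suc k))))"
    by (rule concentrated_cmult[OF concentrated_mult[OF concentrated_out_prob X2]])
  have T3: "concentrated (\<lambda>k G. \<alpha> * of_bool (i = 0) * ((real (Suc k) * in_prob G j) * (real (in_count j G) / real (Suc k))))"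
    by (rule concentrated_cmult[OF head])
  have T4: "concentrated (\<lambda>k G. \<gamma> * of_bool (j = 0) * ((real (Suc k) * out_prob G i) * (real (out_count i G) / real (Suc k))))"
    by (rule concentrated_cmult[OF tail])
  \<comment> \<open>New arcs of an \<open>Internal\<close> step, an order-one term: it is quadratic
    in the degree counts, so closure under products is essential here.\<close>
  have T5: "concentrated (\<lambda>k G. \<beta> * (((real (Suc k) * out_prob G i) * (real (out_count i G) / real (Suc k)))
        * ((real (Suc k) * in_prob G j) * (real (in_count j G) / real (Suc k)))))"
    by (rule concentrated_cmult[OF concentrated_mult[OF tail head]])
  show "concentrated ?R"
    by (rule concentrated_add[OF concentrated_add[OF concentrated_add[OF concentrated_add[OF
          concentrated_add[OF T1 T2] T3] T4] T5] Z])
  fix k and G :: "('v, 'e) pre_digraph" assume G: "G \<in> set_pmf (law k)"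
  note inv = law_invariant[OF G]
  show "0 \<le> ?A k G"
    using prob_nonneg[OF G] params by simp
  show "\<bar>?X (Suc i) (Suc j) G\<bar> \<le> real (card (arcs G0) + 1) * real (Suc k)"
    using edge_count_bound[OF G, of "Suc i" "Suc j"] by simp
  show "measure_pmf.expectation (step G) (?X (Suc i) (Suc j)) = ?X (Suc i) (Suc j) G
      - ?A k G * (?X (Suc i) (Suc j) G / real (Suc k)) + ?R k G"
  proof -
    have cancel: "real (Suc k) * a * (b / real (Suc k)) = a * b" for a b by (simp del: of_nat_Suc)
    have cancel': "?A k G * (b / real (Suc k)) = (\<alpha> + \<beta>) * in_prob G (Suc j) * b + (\<beta> + \<gamma>) * out_prob G (Suc i) * b" for b
      by (simp add: field_simps del: of_nat_Suc)
    have \<alpha>: "\<alpha> = 1 - \<beta> - \<gamma>" using params(4) by simp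
    show ?thesis
      unfolding expectation_edge_count[OF inv(1,2)] cancel cancel' unfolding \<alpha>
      by (simp add: algebra_simps del: of_nat_Suc)
  qed
  fix H assume "H \<in> set_pmf (step G)"
  then show "\<bar>?X (Suc i) (Suc j) H - ?X (Suc i) (Suc j) G\<bar> \<le> real (2 * Suc i + 2 * Suc j + 1)"
    by (rule set_stepE[OF inv(1,2)]) (use edge_count_attach_arc_diff[OF inv(1)] in blast)
qed

lemma concentrated_edge_count: "concentrated (\<lambda>k G. real (edge_count i j G) / real (Suc k))"
proof (induction i arbitrary: j)
  case 0
  show ?case
    by (rule concentrated_small[where M = 0]) (simp add: edge_count_0 law_invariant)
next
  case (Suc i)
  \<comment> \<open>Class \<open>(Suc i, Suc j)\<close> is fed to first order by
    \<open>(Suc i, j)\<close>, the inner hypothesis, and by \<open>(i, Suc j)\<close>, the outer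
    one; the outer hypothesis is therefore kept for all second indices.\<close>
  note IH = Suc.IH
  show ?case
  proof (induction j)
    case 0
    show ?case
      by (rule concentrated_small[where M = 0]) (simp add: edge_count_0 law_invariant)
  next
    case (Suc j)
    show ?case by (rule concentrated_edge_count_Suc[OF Suc IH])
  qed
qed

lemma variance_edge_count_linear:
  obtains K where "\<And>k. measure_pmf.variance (law k) (\<lambda>G. real (edge_count i j G)) \<le> K * real (Suc k)"
proof -
  obtain K where "K \<ge> 0" and K: "\<And>k. mean k (\<lambda>G. (real (edge_count i j G) / real (Suc k)
      - mean k (\<lambda>G. real (edge_count i j G) / real (Suc k)))\<^sup>2) \<le> K / real (Suc k)"
    by (rule concentrated_varianceE[OF concentrated_edge_count]) (rule that)
  have "measure_pmf.variance (law k) (\<lambda>G. real (edge_count i j G)) \<le> K * real (Suc k)" for k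
  proof -
    let ?v = "measure_pmf.variance (law k) (\<lambda>G. real (edge_count i j G))"
    have "?v / (real (Suc k))\<^sup>2 \<le> K / real (Suc k)"
      using K[of k] by (simp add: diff_divide_distrib[symmetric] power_divide del: of_nat_Suc)
    then show ?thesis by (simp add: divide_le_eq power2_eq_square del: of_nat_Suc)
  qed
  then show ?thesis by (rule that)
qed

end

section \<open>Chebyshev's inequality at scale \<open>sqrt t * ln t\<close>\<close>

theorem theorem4:
  fixes \<alpha> \<beta> \<gamma> \<delta>in \<delta>out :: real
    and G0 :: "('v::infinite, 'e::infinite) pre_digraph"
    and d1 d2 :: nat
  assumes "\<alpha> > 0" "\<beta> > 0" "\<gamma> > 0" "\<alpha> + \<beta> + \<gamma> = 1"
    and "\<delta>in > 0" "\<delta>out > 0"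
    and "fin_digraph G0" "verts G0 \<noteq> {}"
    and "d1 \<ge> 2" "d2 \<ge> 2"
  shows "(\<lambda>t. measure_pmf.prob (graph_law \<alpha> \<beta> \<gamma> \<delta>in \<delta>out G0 t)
      {G. \<bar>real (edge_count d1 d2 G) -
            measure_pmf.expectation (graph_law \<alpha> \<beta> \<gamma> \<delta>in \<delta>out G0 t) (\<lambda>H. real (edge_count d1 d2 H))\<bar>
          < sqrt (real t) * ln (real t)}) \<longlonglongrightarrow> 1"
proof -
  interpret scale_free_process \<alpha> \<beta> \<gamma> \<delta>in \<delta>out G0
    by (intro scale_free_process.intro scale_free.intro scale_free_process_axioms.intro assms)
  obtain K where K: "\<And>k. measure_pmf.variance (law k) (\<lambda>G. real (edge_count d1 d2 G)) \<le> K * real (Suc k)"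
    by (rule variance_edge_count_linear[of d1 d2]) (rule that)
  let ?P = "graph_law \<alpha> \<beta> \<gamma> \<delta>in \<delta>out G0"
  let ?X = "\<lambda>G. real (edge_count d1 d2 G)"
  let ?E = "\<lambda>t. measure_pmf.expectation (?P t) ?X"
  let ?good = "\<lambda>t. {G. \<bar>?X G - ?E t\<bar> < sqrt (real t) * ln (real t)}"
  \<comment> \<open>The factor 2 comes from \<open>Suc k \<le> t + 1 \<le> 2 * t\<close>, where
    \<open>k\<close> is the number of steps taken by time \<open>t\<close>; \<open>t \<ge> 2\<close>
    makes the logarithm positive. The factor \<open>t\<close> cancels against the squared
    threshold.\<close>
  have lower: "1 - 2 * \<bar>K\<bar> / (ln (real t))\<^sup>2 \<le> measure_pmf.prob (?P t) (?good t)"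
    if t: "t \<ge> 2" "t \<ge> card (arcs G0)" for t
  proof -
    define k where "k = t - card (arcs G0)"
    have P: "?P t = law k" by (simp add: graph_law_def k_def)
    let ?a = "sqrt (real t) * ln (real t)"
    have a: "?a > 0" using t(1) by (intro mult_pos_pos) auto
    have "measure_pmf.prob (?P t) (- ?good t) = measure_pmf.prob (?P t) {G \<in> space (?P t). ?a \<le> \<bar>?X G - ?E t\<bar>}"
      by (intro arg_cong[where f = "measure_pmf.prob (?P t)"]) auto
    also have "\<dots> \<le> measure_pmf.variance (?P t) ?X / ?a\<^sup>2"
      by (rule measure_pmf.Chebyshev_inequality[OF _ _ a]) (simp_all add: P)
    also have "\<dots> \<le> \<bar>K\<bar> * (2 * real t) / ?a\<^sup>2"
    proof (rule divide_right_mono)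
      have "measure_pmf.variance (?P t) ?X \<le> K * real (Suc k)" unfolding P by (rule K)
      also have "\<dots> \<le> \<bar>K\<bar> * (2 * real t)"
        using t(1) by (intro mult_mono) (auto simp: k_def)
      finally show "measure_pmf.variance (?P t) ?X \<le> \<bar>K\<bar> * (2 * real t)" .
    qed simp
    also have "\<dots> = 2 * \<bar>K\<bar> / (ln (real t))\<^sup>2"
      using t(1) by (simp add: power_mult_distrib)
    finally have "measure_pmf.prob (?P t) (- ?good t) \<le> 2 * \<bar>K\<bar> / (ln (real t))\<^sup>2" .
    moreover have "measure_pmf.prob (?P t) (- ?good t) = 1 - measure_pmf.prob (?P t) (?good t)"
      using measure_pmf.prob_compl[of "?good t" "?P t"] by (simp add: Compl_eq_Diff_UNIV)
    ultimately show ?thesis by linarith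
  qed
  show ?thesis
  proof (rule tendsto_sandwich)
    show "\<forall>\<^sub>F t in sequentially. 1 - 2 * \<bar>K\<bar> / (ln (real t))\<^sup>2 \<le> measure_pmf.prob (?P t) (?good t)"
      using eventually_ge_at_top[of "max 2 (card (arcs G0))"] by eventually_elim (simp add: lower)
    show "\<forall>\<^sub>F t in sequentially. measure_pmf.prob (?P t) (?good t) \<le> 1" by simp
    show "(\<lambda>t. 1 - 2 * \<bar>K\<bar> / (ln (real t))\<^sup>2) \<longlonglongrightarrow> 1" by real_asymp
    show "(\<lambda>_. 1) \<longlonglongrightarrow> (1 :: real)" by simp
  qed
qed

end
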